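(* There exists a quasiregular map of transcendental type $f : \mathbb{R}^2 \to \mathbb{R}^2$ such that $\operatorname{cap} J(f) > 0$ and $J(f) \neq \partial BU(f)$.
   Context: Quasiregular maps: a continuous map $f:\mathbb{R}^2\to\mathbb{R}^2$ is quasiregular if it belongs to the Sobolev space $W^{1,2}_{\mathrm{loc}}(\mathbb{R}^2)$ and there is a constant $K\ge 1$ such that $|Df(x)|^2 \le K \det Df(x)$ for almost every $x$, where $|Df(x)|$ is the operator norm. It is of transcendental type if it has an essential singularity at infinity, i.e. $\lim_{x\to\infty} f(x)$ does not exist in $\mathbb{R}^2\cup\{\infty\}$. Capacity: for an open set $A\subset\mathbb{R}^2$ and a non-empty compact set $C \subset A$, put $\operatorname{cap}(A,C) := \inf_u \int_A |\nabla u|^2\,dx$, where the infimum is over all non-negative $u\in C_0^\infty(A)$ with $u\geq 1$ on $C$. A compact set $C$ has zero (conformal) capacity if it is empty or if $\operatorname{cap}(A,C)=0$ for some (equivalently, every) bounded open set $A\supset C$. A set $S\subset\mathbb{R}^2$ has zero capacity, written $\operatorname{cap} S=0$, if every compact subset of $S$ has zero capacity; otherwise we write $\operatorname{cap} S>0$. Julia set: $J(f)$ is the set of all $x\in\mathbb{R}^2$ such that $\operatorname{cap}\left(\mathbb{R}^2\setminus\bigcup_{k=1}^\infty f^k(U)\right)=0$ for every neighbourhood $U$ of $x$, where $f^k$ is the $k$-th iterate of $f$. Bungee set: the orbit of $x$ is the sequence $(f^n(x))_{n\ge 0}$. $BU(f)$ is the set of points of $\mathbb{R}^2$ whose orbit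 is neither bounded nor tends to infinity. $\partial S$ denotes the boundary of $S$ in $\mathbb{R}^2$. *)

theory Defs
  imports "HOL-Analysis.Analysis"
begin

type_synonym plane = "real^2"

definition partial :: "2 \<Rightarrow> (plane \<Rightarrow> real) \<Rightarrow> plane \<Rightarrow> real" where
  "partial i u x = frechet_derivative u (at x) (axis i 1)"

definition gradient :: "(plane \<Rightarrow> real) \<Rightarrow> plane \<Rightarrow> plane" where
  "gradient u x = (\<chi> i. partial i u x)"

primrec C_times :: "nat \<Rightarrow> (plane \<Rightarrow> real) \<Rightarrow> bool" where
  "C_times 0 u \<longleftrightarrow> continuous_on UNIV u"
| "C_times (Suc k) u \<longleftrightarrow> (\<forall>x. u differentiable (at x)) \<and> (\<forall>i. C_times k (partial i u))"

text \<open>Elements of \<open>C\<^sub>0\<^sup>\<infinity>(A)\<close> are represented by their extensions by zero to the whole plane.\<close>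

definition test_functions :: "plane set \<Rightarrow> (plane \<Rightarrow> real) set" where
  "test_functions A =
     {u. (\<forall>k. C_times k u) \<and> compact (closure {x. u x \<noteq> 0}) \<and> closure {x. u x \<noteq> 0} \<subseteq> A}"

definition L2_loc :: "(plane \<Rightarrow> real) \<Rightarrow> bool" where
  "L2_loc g \<longleftrightarrow> g \<in> borel_measurable lebesgue \<and>
     (\<forall>C. compact C \<longrightarrow> set_integrable lebesgue C (\<lambda>x. (g x)\<^sup>2))"

definition has_weak_partial :: "2 \<Rightarrow> (plane \<Rightarrow> real) \<Rightarrow> (plane \<Rightarrow> real) \<Rightarrow> bool" where
  "has_weak_partial j g h \<longleftrightarrow>
     (\<forall>\<phi>\<in>test_functions UNIV.
        (LINT x|lebesgue. g x * partial j \<phi> x) = - (LINT x|lebesgue. h x * \<phi> x))"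

text \<open>\<open>f\<close> belongs to \<open>W\<^sup>1\<^sup>,\<^sup>2\<close> locally, with weak derivative \<open>Df = D\<close>; such a \<open>D\<close> is unique up
  to null sets.\<close>

definition W12_loc_deriv :: "(plane \<Rightarrow> plane) \<Rightarrow> (plane \<Rightarrow> real^2^2) \<Rightarrow> bool" where
  "W12_loc_deriv f D \<longleftrightarrow>
     (\<forall>i. L2_loc (\<lambda>x. f x $ i)) \<and>
     (\<forall>i j. L2_loc (\<lambda>x. D x $ i $ j) \<and>
            has_weak_partial j (\<lambda>x. f x $ i) (\<lambda>x. D x $ i $ j))"

definition quasiregular :: "(plane \<Rightarrow> plane) \<Rightarrow> bool" where
  "quasiregular f \<longleftrightarrow> continuous_on UNIV f \<and>
     (\<exists>D. W12_loc_deriv f D \<and>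
        (\<exists>K\<ge>1. AE x in lebesgue. (onorm (\<lambda>v. D x *v v))\<^sup>2 \<le> K * det (D x)))"

definition transcendental_type :: "(plane \<Rightarrow> plane) \<Rightarrow> bool" where
  "transcendental_type f \<longleftrightarrow>
     \<not> (\<exists>l. (f \<longlongrightarrow> l) at_infinity) \<and> \<not> filterlim f at_infinity at_infinity"

definition capacity :: "plane set \<Rightarrow> plane set \<Rightarrow> ennreal" where
  "capacity A C =
     (INF u \<in> {u \<in> test_functions A. (\<forall>x. 0 \<le> u x) \<and> (\<forall>x\<in>C. 1 \<le> u x)}.
        \<integral>\<^sup>+x\<in>A. ennreal ((norm (gradient u x))\<^sup>2) \<partial>lebesgue)"

definition compact_zero_capacity :: "plane set \<Rightarrow> bool" where
  "compact_zero_capacity C \<longleftrightarrow>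
     C = {} \<or> (\<exists>A. open A \<and> bounded A \<and> C \<subseteq> A \<and> capacity A C = 0)"

definition zero_capacity :: "plane set \<Rightarrow> bool" where
  "zero_capacity S \<longleftrightarrow> (\<forall>C. compact C \<and> C \<subseteq> S \<longrightarrow> compact_zero_capacity C)"

definition julia_set :: "(plane \<Rightarrow> plane) \<Rightarrow> plane set" where
  "julia_set f =
     {x. \<forall>U. open U \<and> x \<in> U \<longrightarrow> zero_capacity (UNIV - (\<Union>k\<in>{1..}. (f ^^ k) ` U))}"

definition bungee_set :: "(plane \<Rightarrow> plane) \<Rightarrow> plane set" where
  "bungee_set f =
     {x. \<not> bounded (range (\<lambda>n. (f ^^ n) x)) \<and>
         \<not> filterlim (\<lambda>n. (f ^^ n) x) at_infinity sequentially}"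

end

theory Submission
  imports Defs
begin

text \<open>
  The map is \<open>z + exp (- \<i> z)\<close> in the upper half-plane, the identity for \<open>y \<le> -3\<close>, and it leaves
  the half-plane \<open>y < -2\<close> invariant. Points of the vertical line \<open>x = - \<pi>/2\<close> move up this
  line under an exponentially expanding map, so a small disc around such a point grows until its
  image contains a disc of radius \<open>8\<close>; two more iterates of that disc contain any prescribed point.
  Hence the line segment \<open>x = - \<pi>/2\<close>, \<open>3 \<le> y \<le> 4\<close> lies in the Julia set, and segments have
  positive capacity.

  In the strip \<open>-3 < y < -2\<close> orbits tend to the line \<open>y = -3\<close> of fixed points so slowly that a
  horizontal displacement which is Lipschitz in \<open>y\<close> can still sum up to unbounded oscillations.
  All points of the strip then belong to the bungee set, and the fixed points on \<open>y = -3\<close> belong to its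
  boundary, but not to the Julia set, as the invariant half-plane omits a segment.
\<close>

section \<open>Weak derivatives of piecewise smooth functions\<close>

text \<open>The distortion bound keeps the shear in the strip bounded, so the horizontal
  displacement is O(u) in the distance u to the line of fixed points. If u decayed geometrically,
  these displacements would be summable and all orbits in the strip bounded. So the attraction has
  to be parabolic: u_n is about 2/n, and the sum of the u_n diverges like a logarithm. The
  displacement is prescribed as a coboundary of \<open>wave\<close> at \<open>- ln u\<close>. The
  abscissa is then an explicit function of the height, and all that remains is to choose
  \<open>wave\<close> unbounded, oscillating, and with a bounded and Lipschitz derivative.

  Two iterates of a disc of radius 8 suffice because exp (- i z) has period 2 pi. Every w has
  preimages with real part near - 2 pi n for all large n, so every large annulus with ratio of radii
  e^4 contains a preimage of w. A disc of radius 8 high up on the vertical line covers such an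
  annulus in one step.\<close>

text \<open>Dominated convergence; the dominating function lives on a ball of radius
  \<open>R + 1\<close> because steps have length at most 1. The weight \<open>w\<close> allows two
  uses: constant 1 for weak derivatives, and the indicator of a half-strip for the capacity of a
  segment.\<close>

lemma difference_quotient_integral_limit:
  fixes \<psi> k w :: "'a::euclidean_space \<Rightarrow> real" and e :: 'a
  assumes [measurable]: "\<psi> \<in> borel_measurable borel" "k \<in> borel_measurable borel"
      "w \<in> borel_measurable borel"
    and w: "\<And>x. \<bar>w x\<bar> \<le> 1"
    and supp: "\<And>x. norm x \<ge> R \<Longrightarrow> \<psi> x = 0"
    and e: "norm e = 1"
    and lip: "AE x in lborel. \<forall>t. 0 < t \<longrightarrow> t \<le> 1 \<longrightarrow> \<bar>\<psi> (x + t *\<^sub>R e) - \<psi> x\<bar> \<le> M * t"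
    and der: "AE x in lborel. ((\<lambda>t. (\<psi> (x + t *\<^sub>R e) - \<psi> x) / t) \<longlongrightarrow> k x) (at 0)"
  shows "(\<lambda>n. LINT x|lborel. w x * ((\<psi> (x + inverse (real (Suc n)) *\<^sub>R e) - \<psi> x) / inverse (real (Suc n))))
           \<longlonglongrightarrow> (LINT x|lborel. w x * k x)"
proof (rule integral_dominated_convergence
    [where w = "\<lambda>x. M * indicator (cball 0 (R + 1)) x"])
  show "integrable lborel (\<lambda>x. M * indicator (cball 0 (R + 1)) x :: real)"
    by (intro integrable_mult_right integrable_real_indicator emeasure_bounded_finite) auto
  show "AE x in lborel. (\<lambda>i. w x * ((\<psi> (x + inverse (real (Suc i)) *\<^sub>R e) - \<psi> x) / inverse (real (Suc i))))
           \<longlonglongrightarrow> w x * k x"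
    using der
  proof eventually_elim
    case (elim x)
    have "filterlim (\<lambda>n. inverse (real (Suc n))) (at 0) sequentially"
      using LIMSEQ_inverse_real_of_nat by (simp add: filterlim_at)
    from filterlim_compose[OF elim this] show ?case
      by (intro tendsto_mult tendsto_const)
  qed
  show "AE x in lborel. norm (w x * ((\<psi> (x + inverse (real (Suc i)) *\<^sub>R e) - \<psi> x) / inverse (real (Suc i))))
          \<le> M * indicator (cball 0 (R + 1)) x" for i
    using lip
  proof eventually_elim
    case (elim x)
    define t where "t = inverse (real (Suc i))"
    have t: "0 < t" "t \<le> 1"
      by (auto simp: t_def field_simps)
    have L: "\<bar>\<psi> (x + t *\<^sub>R e) - \<psi> x\<bar> \<le> M * t"
      using elim t by blast
    show ?case
    proof (cases "norm x \<le> R + 1")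
      case True
      have "norm (w x * ((\<psi> (x + t *\<^sub>R e) - \<psi> x) / t)) \<le> 1 * (\<bar>\<psi> (x + t *\<^sub>R e) - \<psi> x\<bar> / t)"
        unfolding real_norm_def abs_mult using w[of x] t
        by (intro mult_mono) auto
      also have "\<dots> \<le> M"
        using L t by (simp add: field_simps)
      finally show ?thesis
        using True by (simp add: t_def)
    next
      case False
      have "norm x \<le> norm (x + t *\<^sub>R e) + norm (t *\<^sub>R e)"
        by (metis add_diff_cancel_right' norm_triangle_ineq4)
      then have "norm (x + t *\<^sub>R e) \<ge> R"
        using False t e by simp
      then have "\<psi> (x + t *\<^sub>R e) = 0" "\<psi> x = 0"
        using supp False by auto
      then show ?thesis
        using False by (simp add: t_def)
    qed
  qed
qed auto

lemma integral_translate: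
  fixes g :: "'a::euclidean_space \<Rightarrow> real"
  assumes [measurable]: "g \<in> borel_measurable borel"
  shows "(LINT x|lborel. g (x + c)) = (LINT x|lborel. g x)"
proof -
  have "(LINT x|lborel. g x) = (LINT x|distr lborel borel ((+) c). g x)"
    by (simp add: lborel_distr_plus)
  also have "\<dots> = (LINT x|lborel. g (c + x))"
    by (rule integral_distr) auto
  finally show ?thesis
    by (simp add: add.commute)
qed

lemma integrable_bounded_support:
  fixes g :: "'a::euclidean_space \<Rightarrow> real"
  assumes [measurable]: "g \<in> borel_measurable borel"
    and "\<And>x. \<bar>g x\<bar> \<le> B" "\<And>x. norm x \<ge> R \<Longrightarrow> g x = 0"
  shows "integrable lborel g"
proof (rule Bochner_Integration.integrable_bound)
  show "integrable lborel (\<lambda>x. B * indicator (cball 0 R) x :: real)"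
    by (intro integrable_mult_right integrable_real_indicator emeasure_bounded_finite) auto
  have "0 \<le> B"
    using assms(2)[of 0] by linarith
  show "AE x in lborel. norm (g x) \<le> norm (B * indicator (cball 0 R) x)"
    using assms(2,3) \<open>0 \<le> B\<close> by (intro AE_I2) (auto simp: indicator_def abs_le_iff)
qed auto

text \<open>Difference quotients have vanishing integral by translation invariance, so no Fubini argument is needed.\<close>

lemma integral_directional_derivative_eq_0:
  fixes \<psi> k :: "'a::euclidean_space \<Rightarrow> real" and e :: 'a
  assumes [measurable]: "\<psi> \<in> borel_measurable borel" "k \<in> borel_measurable borel"
    and bdd: "\<And>x. \<bar>\<psi> x\<bar> \<le> B"
    and supp: "\<And>x. norm x \<ge> R \<Longrightarrow> \<psi> x = 0"
    and e: "norm e = 1"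
    and lip: "AE x in lborel. \<forall>t. 0 < t \<longrightarrow> t \<le> 1 \<longrightarrow> \<bar>\<psi> (x + t *\<^sub>R e) - \<psi> x\<bar> \<le> M * t"
    and der: "AE x in lborel. ((\<lambda>t. (\<psi> (x + t *\<^sub>R e) - \<psi> x) / t) \<longlongrightarrow> k x) (at 0)"
  shows "(LINT x|lborel. k x) = 0"
proof -
  have int: "integrable lborel \<psi>"
    by (rule integrable_bounded_support[OF _ bdd supp]) auto
  have int': "integrable lborel (\<lambda>x. \<psi> (x + c))" for c
  proof (rule integrable_bounded_support[OF _ bdd])
    show "\<psi> (x + c) = 0" if "norm x \<ge> R + norm c" for x
      using supp norm_triangle_ineq4[of "x + c" c] that by force
  qed auto
  have "(LINT x|lborel. 1 * ((\<psi> (x + inverse (real (Suc n)) *\<^sub>R e) - \<psi> x) / inverse (real (Suc n)))) = 0" for n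
    using int int' integral_translate[of \<psi>] by simp
  moreover have "(\<lambda>n. LINT x|lborel. 1 * ((\<psi> (x + inverse (real (Suc n)) *\<^sub>R e) - \<psi> x) / inverse (real (Suc n))))
           \<longlonglongrightarrow> (LINT x|lborel. 1 * k x)"
    by (rule difference_quotient_integral_limit[OF _ _ _ _ supp e lip der]) auto
  ultimately show ?thesis
    by (simp add: LIMSEQ_const_iff)
qed

text \<open>The fundamental theorem of calculus tolerates finitely many exceptional points, so kinks
  do not spoil the Lipschitz bound.\<close>

lemma abs_diff_le_piecewise:
  fixes w w' :: "real \<Rightarrow> real"
  assumes "0 \<le> t" "finite E" "continuous_on {0..t} w"
    and "\<And>s. s \<in> {0<..<t} - E \<Longrightarrow> (w has_real_derivative w' s) (at s)"
    and "\<And>s. \<bar>w' s\<bar> \<le> M"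
  shows "\<bar>w t - w 0\<bar> \<le> M * t"
proof -
  have "(w' has_integral (w t - w 0)) {0..t}"
    using assms by (intro fundamental_theorem_of_calculus_interior_strong[of E])
      (auto simp: has_real_derivative_iff_has_vector_derivative)
  then have "norm (w t - w 0) \<le> M * measure lborel (cbox 0 t)"
    using assms order_trans[OF abs_ge_zero assms(5)[of 0]]
    by (intro has_integral_bound[of M w']) auto
  then show ?thesis
    using assms by simp
qed

lemma test_function_facts:
  assumes "\<phi> \<in> test_functions A"
  shows "\<phi> differentiable (at x)"
    and "continuous_on UNIV \<phi>"
    and "continuous_on UNIV (partial i \<phi>)"
proof -
  have "C_times (Suc 0) \<phi>"
    using assms by (auto simp: test_functions_def)
  then show "\<phi> differentiable (at x)" "continuous_on UNIV \<phi>" "continuous_on UNIV (partial i \<phi>)"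
    by (auto simp: continuous_at_imp_continuous_on differentiable_imp_continuous_within)
qed

lemma test_function_line_derivative:
  assumes "\<phi> \<in> test_functions A"
  shows "((\<lambda>t. \<phi> (x + t *\<^sub>R axis i 1)) has_real_derivative partial i \<phi> (x + s *\<^sub>R axis i 1)) (at s)"
proof -
  have D: "(\<phi> has_derivative frechet_derivative \<phi> (at (x + s *\<^sub>R axis i 1))) (at (x + s *\<^sub>R axis i 1))"
    using test_function_facts(1)[OF assms] by (simp add: frechet_derivative_works[symmetric])
  have "((\<lambda>t. \<phi> (x + t *\<^sub>R axis i 1)) has_derivative
      (\<lambda>h. frechet_derivative \<phi> (at (x + s *\<^sub>R axis i 1)) (h *\<^sub>R axis i 1))) (at s)"
    by (rule has_derivative_compose[where f = "\<lambda>t. x + t *\<^sub>R axis i 1", OF _ D]) (auto intro!: derivative_eq_intros)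
  moreover have "frechet_derivative \<phi> (at (x + s *\<^sub>R axis i 1)) (h *\<^sub>R axis i 1)
       = partial i \<phi> (x + s *\<^sub>R axis i 1) * h" for h
    using linear_cmul[OF has_derivative_linear[OF D]] by (simp add: partial_def)
  ultimately show ?thesis
    by (simp add: has_field_derivative_def)
qed

lemma test_function_support:
  assumes "\<phi> \<in> test_functions A"
  obtains R where "\<And>x. norm x \<ge> R \<Longrightarrow> \<phi> x = 0" "\<And>x i. norm x \<ge> R \<Longrightarrow> partial i \<phi> x = 0"
proof -
  have "bounded (closure {x. \<phi> x \<noteq> 0})"
    using assms by (auto simp: test_functions_def compact_imp_bounded)
  then obtain R where R: "\<And>x. x \<in> closure {x. \<phi> x \<noteq> 0} \<Longrightarrow> norm x \<le> R"
    by (auto simp: bounded_iff)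
  have z: "\<phi> x = 0" if "norm x > R" for x
    using R[of x] closure_subset[of "{x. \<phi> x \<noteq> 0}"] that by fastforce
  have "partial i \<phi> x = 0" if x: "norm x > R" for x i
  proof -
    have "(\<phi> has_derivative (\<lambda>_. 0)) (at x)"
    proof (rule has_derivative_transform_within_open[where f = "\<lambda>_. 0"])
      show "open (- cball 0 R :: plane set)" "x \<in> - cball 0 R"
        using x by auto
    qed (use z in auto)
    then show ?thesis
      unfolding partial_def by (simp flip: frechet_derivative_at)
  qed
  with z show thesis
    using that[of "R + 1"] by force
qed

lemma continuous_bounded_on_cball:
  fixes g :: "'a::euclidean_space \<Rightarrow> real"
  assumes "continuous_on UNIV g"
  obtains B where "B \<ge> 0" "\<And>x. norm x \<le> R \<Longrightarrow> \<bar>g x\<bar> \<le> B"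
proof -
  have "compact (g ` cball 0 R)"
    by (rule compact_continuous_image[OF continuous_on_subset[OF assms]]) auto
  then have "bounded (g ` cball 0 R)"
    by (rule compact_imp_bounded)
  then obtain b where "b > 0" "\<forall>x\<in>cball 0 R. \<bar>g x\<bar> \<le> b"
    by (auto simp: bounded_pos)
  then show thesis
    using that[of b] by simp
qed

text \<open>Integration by parts: \<open>g * \<phi>\<close> has compact support and classical
  derivative \<open>g * partial j \<phi> + h * \<phi>\<close> off finitely many horizontal lines, so
  this derivative has integral 0. The set \<open>E\<close> holds the heights at which the pieces of
  the map are glued.\<close>

lemma has_weak_partial_piecewise:
  fixes g h :: "plane \<Rightarrow> real"
  assumes g: "continuous_on UNIV g"
    and h[measurable]: "h \<in> borel_measurable borel"
    and hb: "\<And>R. \<exists>B. \<forall>x. norm x \<le> R \<longrightarrow> \<bar>h x\<bar> \<le> B"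
    and E: "finite E"
    and der: "\<And>x. x $ 2 \<notin> E \<Longrightarrow> ((\<lambda>t. g (x + t *\<^sub>R axis j 1)) has_real_derivative h x) (at 0)"
  shows "has_weak_partial j g h"
  unfolding has_weak_partial_def
proof
  fix \<phi> assume \<phi>: "\<phi> \<in> test_functions UNIV"
  let ?e = "axis j 1 :: plane"
  have [measurable]: "g \<in> borel_measurable borel" "\<phi> \<in> borel_measurable borel"
     "partial j \<phi> \<in> borel_measurable borel"
    using g test_function_facts[OF \<phi>] by (auto intro: borel_measurable_continuous_onI)
  obtain R where R: "\<And>x. norm x \<ge> R \<Longrightarrow> \<phi> x = 0" "\<And>x i. norm x \<ge> R \<Longrightarrow> partial i \<phi> x = 0"
    using test_function_support[OF \<phi>] by metis
  obtain Bg where Bg: "Bg \<ge> 0" "\<And>x. norm x \<le> R \<Longrightarrow> \<bar>g x\<bar> \<le> Bg"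
    using continuous_bounded_on_cball[OF g] by metis
  obtain Bp where Bp: "Bp \<ge> 0" "\<And>x. norm x \<le> R \<Longrightarrow> \<bar>\<phi> x\<bar> \<le> Bp"
    using continuous_bounded_on_cball[OF test_function_facts(2)[OF \<phi>]] by metis
  obtain Bd where Bd: "Bd \<ge> 0" "\<And>x. norm x \<le> R \<Longrightarrow> \<bar>partial j \<phi> x\<bar> \<le> Bd"
    using continuous_bounded_on_cball[OF test_function_facts(3)[OF \<phi>]] by metis
  obtain Bh where Bh: "\<And>x. norm x \<le> R \<Longrightarrow> \<bar>h x\<bar> \<le> Bh"
    using hb by metis
  define \<psi> where "\<psi> x = g x * \<phi> x" for x
  define k where "k x = g x * partial j \<phi> x + h x * \<phi> x" for x
  have b1: "\<bar>g x * \<phi> x\<bar> \<le> Bg * Bp" for x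
    using Bg Bp R(1)[of x] by (cases "norm x \<le> R") (auto simp: abs_mult intro: mult_mono)
  have b2: "\<bar>g x * partial j \<phi> x\<bar> \<le> Bg * Bd" for x
    using Bg Bd R(2)[of x] by (cases "norm x \<le> R") (auto simp: abs_mult intro: mult_mono)
  have b3: "\<bar>h x * \<phi> x\<bar> \<le> \<bar>Bh\<bar> * Bp" for x
  proof (cases "norm x \<le> R")
    case True
    have "\<bar>h x\<bar> \<le> \<bar>Bh\<bar>"
      using Bh[OF True] by linarith
    then show ?thesis
      using Bp True by (auto simp: abs_mult intro: mult_mono)
  qed (use R(1)[of x] Bp in auto)
  define M where "M = Bg * Bd + \<bar>Bh\<bar> * Bp"
  have kM: "\<bar>k x\<bar> \<le> M" for x
    using b2[of x] b3[of x] by (simp add: k_def M_def)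
  have [measurable]: "\<psi> \<in> borel_measurable borel" "k \<in> borel_measurable borel"
    unfolding \<psi>_def[abs_def] k_def[abs_def] by auto
  have c\<psi>: "continuous_on UNIV \<psi>"
    unfolding \<psi>_def[abs_def] using g test_function_facts(2)[OF \<phi>] by (intro continuous_intros)
  have g': "((\<lambda>t. g (x + t *\<^sub>R ?e)) has_real_derivative h (x + s *\<^sub>R ?e)) (at s)"
    if "(x + s *\<^sub>R ?e) $ 2 \<notin> E" for x s
    using DERIV_shift[of "\<lambda>t. g (x + t *\<^sub>R ?e)" "h (x + s *\<^sub>R ?e)" 0 s] der[OF that]
    by (simp add: algebra_simps)
  have \<psi>': "((\<lambda>t. \<psi> (x + t *\<^sub>R ?e)) has_real_derivative k (x + s *\<^sub>R ?e)) (at s)"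
    if "(x + s *\<^sub>R ?e) $ 2 \<notin> E" for x s
    unfolding \<psi>_def k_def
    by (rule DERIV_cong[OF DERIV_mult[OF g'[OF that] test_function_line_derivative[OF \<phi>]]]) simp
  define N :: "plane set" where "N = (\<Union>c\<in>E. {x. x $ 2 = c})"
  have "negligible {x::plane. x $ 2 = c}" for c
    using negligible_standard_hyperplane[of "axis 2 1 :: plane" c]
    by (simp add: cart_eq_inner_axis axis_in_Basis_iff)
  then have "negligible N"
    unfolding N_def using E by (intro negligible_Union) auto
  then have AEN: "AE x in lborel. x \<notin> N"
  proof -
    have "AE x in lebesgue. x \<notin> N"
      using \<open>negligible N\<close> by (intro AE_not_in) (simp add: negligible_iff_null_sets)
    moreover have "N \<in> sets borel"
      unfolding N_def by (intro sets.finite_UN[OF E]) measurable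
    ultimately show ?thesis
      by (subst (asm) AE_completion_iff) auto
  qed
  have "(LINT x|lborel. k x) = 0"
  proof (rule integral_directional_derivative_eq_0)
    show "\<bar>\<psi> x\<bar> \<le> Bg * Bp" for x
      using b1 by (simp add: \<psi>_def)
    show "\<psi> x = 0" if "norm x \<ge> R" for x
      using R(1)[OF that] by (simp add: \<psi>_def)
    show "norm ?e = 1"
      by simp
    show "AE x in lborel. ((\<lambda>t. (\<psi> (x + t *\<^sub>R ?e) - \<psi> x) / t) \<longlongrightarrow> k x) (at 0)"
      using AEN
    proof eventually_elim
      case (elim x)
      then have "(x + 0 *\<^sub>R ?e) $ 2 \<notin> E"
        by (auto simp: N_def)
      from \<psi>'[OF this] show ?case
        by (simp add: DERIV_def)
    qed
    show "AE x in lborel. \<forall>t. 0 < t \<longrightarrow> t \<le> 1 \<longrightarrow> \<bar>\<psi> (x + t *\<^sub>R ?e) - \<psi> x\<bar> \<le> M * t"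
      using AEN
    proof eventually_elim
      case (elim x)
      \<comment> \<open>Off \<open>N\<close>, a horizontal line never meets a seam, and a vertical
        line meets each seam exactly once; either way only finitely many points of the line are
        bad.\<close>
      define E' where "E' = {s. (x + s *\<^sub>R ?e) $ 2 \<in> E}"
      have fin: "finite E'"
      proof (cases "j = 2")
        case True
        have "E' = (\<lambda>c. c - x $ 2) ` E"
          unfolding E'_def using True by (force simp: axis_def image_iff)
        then show ?thesis
          using E by simp
      next
        case False
        then have "E' = {}"
          using elim by (auto simp: E'_def N_def axis_def)
        then show ?thesis by simp
      qed
      show ?case
      proof (intro allI impI)
        fix t :: real assume "0 < t" "t \<le> 1"
        have "\<bar>\<psi> (x + t *\<^sub>R ?e) - \<psi> (x + 0 *\<^sub>R ?e)\<bar> \<le> M * t"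
        proof (rule abs_diff_le_piecewise[OF _ fin, where w' = "\<lambda>s. k (x + s *\<^sub>R ?e)"])
          show "continuous_on {0..t} (\<lambda>t. \<psi> (x + t *\<^sub>R ?e))"
            by (rule continuous_on_compose2[OF c\<psi>]) (auto intro!: continuous_intros)
        qed (use \<open>0 < t\<close> kM \<psi>' in \<open>auto simp: E'_def\<close>)
        then show "\<bar>\<psi> (x + t *\<^sub>R ?e) - \<psi> x\<bar> \<le> M * t"
          by simp
      qed
    qed
  qed auto
  moreover have "integrable lborel (\<lambda>x. g x * partial j \<phi> x)"
    by (rule integrable_bounded_support[OF _ b2, where R = R]) (use R in auto)
  moreover have "integrable lborel (\<lambda>x. h x * \<phi> x)"
    by (rule integrable_bounded_support[OF _ b3, where R = R]) (use R in auto)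
  ultimately have "(LINT x|lborel. g x * partial j \<phi> x) + (LINT x|lborel. h x * \<phi> x) = 0"
    by (simp add: k_def)
  then show "(LINT x|lebesgue. g x * partial j \<phi> x) = - (LINT x|lebesgue. h x * \<phi> x)"
    by (simp add: integral_completion)
qed

lemma L2_loc_locally_bounded:
  fixes g :: "plane \<Rightarrow> real"
  assumes [measurable]: "g \<in> borel_measurable borel"
    and b: "\<And>R. \<exists>B. \<forall>x. norm x \<le> R \<longrightarrow> \<bar>g x\<bar> \<le> B"
  shows "L2_loc g"
  unfolding L2_loc_def
proof (intro conjI allI impI)
  show "g \<in> borel_measurable lebesgue"
    by (auto intro: measurable_completion)
  fix C :: "plane set" assume C: "compact C"
  then obtain R where R: "\<And>x. x \<in> C \<Longrightarrow> norm x \<le> R"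
    using compact_imp_bounded[OF C] by (auto simp: bounded_iff)
  obtain B where B: "\<And>x. norm x \<le> R \<Longrightarrow> \<bar>g x\<bar> \<le> B"
    using b by metis
  have [measurable]: "C \<in> sets borel"
    using C by (simp add: borel_compact)
  have "integrable lborel (\<lambda>x. indicator C x * (g x)\<^sup>2)"
  proof (rule integrable_bounded_support)
    show "indicator C x * (g x)\<^sup>2 = 0" if "norm x \<ge> R + 1" for x
      using R[of x] that by (auto simp: indicator_def)
    show "\<bar>indicator C x * (g x)\<^sup>2\<bar> \<le> B\<^sup>2" for x
      using R[of x] B[of x] power_mono[of "\<bar>g x\<bar>" B 2] by (auto simp: indicator_def)
  qed auto
  then show "set_integrable lebesgue C (\<lambda>x. (g x)\<^sup>2)"
    unfolding set_integrable_def by (subst integrable_completion) auto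
qed

section \<open>Segments have positive capacity\<close>

lemma test_function_lipschitz:
  assumes u: "u \<in> test_functions A"
  obtains M where "M \<ge> 0" "\<And>x t. t \<ge> 0 \<Longrightarrow> \<bar>u (x + t *\<^sub>R axis i 1) - u x\<bar> \<le> M * t"
    "\<And>x. \<bar>partial i u x\<bar> \<le> M"
proof -
  obtain R where R: "\<And>x i. norm x \<ge> R \<Longrightarrow> partial i u x = 0"
    using test_function_support[OF u] by metis
  obtain M where M: "M \<ge> 0" "\<And>x. norm x \<le> R \<Longrightarrow> \<bar>partial i u x\<bar> \<le> M"
    using continuous_bounded_on_cball[OF test_function_facts(3)[OF u]] by metis
  have M': "\<bar>partial i u x\<bar> \<le> M" for x
    using M R by (cases "norm x \<le> R") auto
  have "\<bar>u (x + t *\<^sub>R axis i 1) - u (x + 0 *\<^sub>R axis i 1)\<bar> \<le> M * t" if "t \<ge> 0" for x t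
  proof (rule abs_diff_le_piecewise[OF that, where E = "{}" and w' = "\<lambda>s. partial i u (x + s *\<^sub>R axis i 1)"])
    show "continuous_on {0..t} (\<lambda>t. u (x + t *\<^sub>R axis i 1))"
      by (rule continuous_on_compose2[OF test_function_facts(2)[OF u]]) (auto intro!: continuous_intros)
  qed (use test_function_line_derivative[OF u] M' in auto)
  then show thesis
    using that M M' by simp
qed

definition vertical_segment :: "real \<Rightarrow> real \<Rightarrow> real \<Rightarrow> plane set" where
  "vertical_segment a c d = {x. x $ 1 = a \<and> c \<le> x $ 2 \<and> x $ 2 \<le> d}"

lemma compact_vertical_segment: "compact (vertical_segment a c d)"
proof -
  have "vertical_segment a c d = cbox (vector [a, c]) (vector [a, d])"
    by (auto simp: vertical_segment_def mem_box_cart forall_2 vector_2)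
  then show ?thesis
    by simp
qed

lemma vertical_segment_nonempty: "c \<le> d \<Longrightarrow> vertical_segment a c d \<noteq> {}"
  by (auto simp: vertical_segment_def intro!: exI[of _ "vector [a, c]"])

text \<open>For small \<open>t\<close>, translating the half-strip by \<open>t\<close> loses a rectangle of width \<open>t\<close> adjacent to the
  segment, on which \<open>u \<ge> 1 - O(t)\<close>.\<close>

lemma flux_right_of_segment:
  assumes u: "u \<in> test_functions A" and pos: "\<And>x. 0 \<le> u x"
    and one: "\<And>x. x \<in> vertical_segment a c d \<Longrightarrow> 1 \<le> u x" and cd: "c \<le> d"
  shows "(LINT x|lborel. indicator {x. a < x $ 1 \<and> c \<le> x $ 2 \<and> x $ 2 \<le> d} x * partial 1 u x) \<le> - (d - c)"
proof -
  let ?e = "axis 1 1 :: plane"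
  define Q :: "plane set" where "Q = {x. a < x $ 1 \<and> c \<le> x $ 2 \<and> x $ 2 \<le> d}"
  have Q[measurable]: "Q \<in> sets borel"
    unfolding Q_def by measurable
  have [measurable]: "u \<in> borel_measurable borel" "partial 1 u \<in> borel_measurable borel"
    using test_function_facts[OF u] by (auto intro: borel_measurable_continuous_onI)
  obtain R where R: "\<And>x. norm x \<ge> R \<Longrightarrow> u x = 0" "\<And>x i. norm x \<ge> R \<Longrightarrow> partial i u x = 0"
    using test_function_support[OF u] by metis
  obtain B where B: "B \<ge> 0" "\<And>x. norm x \<le> R \<Longrightarrow> \<bar>u x\<bar> \<le> B"
    using continuous_bounded_on_cball[OF test_function_facts(2)[OF u]] by metis
  have B': "\<bar>u x\<bar> \<le> B" for x
    using B R(1)[of x] by (cases "norm x \<le> R") auto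
  obtain M where M: "M \<ge> 0" "\<And>x t. t \<ge> 0 \<Longrightarrow> \<bar>u (x + t *\<^sub>R ?e) - u x\<bar> \<le> M * t"
    using test_function_lipschitz[OF u, of 1] by metis
  have lim: "(\<lambda>n. LINT x|lborel. indicator Q x * ((u (x + inverse (real (Suc n)) *\<^sub>R ?e) - u x) / inverse (real (Suc n))))
           \<longlonglongrightarrow> (LINT x|lborel. indicator Q x * partial 1 u x)"
  proof (rule difference_quotient_integral_limit[where R = R and M = M])
    show "\<bar>indicator Q x :: real\<bar> \<le> 1" for x
      by (simp add: indicator_def)
    show "AE x in lborel. ((\<lambda>t. (u (x + t *\<^sub>R ?e) - u x) / t) \<longlongrightarrow> partial 1 u x) (at 0)"
      using test_function_line_derivative[OF u, of _ 1 0] by (intro AE_I2) (simp add: DERIV_def)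
  qed (use R M in auto)
  have step: "(LINT x|lborel. indicator Q x * ((u (x + t *\<^sub>R ?e) - u x) / t)) \<le> - (d - c) * (1 - M * t)"
    if t: "t > 0" for t
  proof -
    \<comment> \<open>\<open>S'\<close> is the half-open rectangle that the translation really
      loses. \<open>S\<close> adds a null edge to make it a closed box, whose volume is known and
      whose points can be moved back onto the segment.\<close>
    define S :: "plane set" where "S = cbox (vector [a, c]) (vector [a + t, d])"
    define S' :: "plane set" where "S' = {x. a < x $ 1 \<and> x $ 1 \<le> a + t \<and> c \<le> x $ 2 \<and> x $ 2 \<le> d}"
    have [measurable]: "S' \<in> sets borel"
      unfolding S'_def by measurable
    have S: "x \<in> S \<longleftrightarrow> a \<le> x $ 1 \<and> x $ 1 \<le> a + t \<and> c \<le> x $ 2 \<and> x $ 2 \<le> d" for x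
      by (auto simp: S_def mem_box_cart forall_2 vector_2)
    have intb: "integrable lborel (\<lambda>x. indicator P x * u (x + v))" if [measurable]: "P \<in> sets borel" for P v
    proof (rule integrable_bounded_support[where B = B and R = "R + norm v"])
      show "\<bar>indicator P x * u (x + v)\<bar> \<le> B" for x
        using B B' by (auto simp: indicator_def)
      show "indicator P x * u (x + v) = 0" if "R + norm v \<le> norm x" for x
        using R(1) norm_triangle_ineq4[of "x + v" v] that by force
    qed measurable
    have "(LINT x|lborel. indicator Q x * ((u (x + t *\<^sub>R ?e) - u x) / t))
        = ((LINT x|lborel. indicator Q x * u (x + t *\<^sub>R ?e)) - (LINT x|lborel. indicator Q x * u x)) / t"
      using intb[OF Q, of "t *\<^sub>R ?e"] intb[OF Q, of 0]
      by (subst Bochner_Integration.integral_diff[symmetric]) (auto simp: algebra_simps diff_divide_distrib)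
    also have "(LINT x|lborel. indicator Q x * u (x + t *\<^sub>R ?e)) = (LINT x|lborel. indicator Q (x - t *\<^sub>R ?e) * u x)"
      using integral_translate[of "\<lambda>x. indicator Q (x - t *\<^sub>R ?e) * u x" "t *\<^sub>R ?e"] by simp
    also have "(LINT x|lborel. indicator Q (x - t *\<^sub>R ?e) * u x)
       = (LINT x|lborel. indicator Q x * u x) - (LINT x|lborel. indicator S' x * u x)"
    proof -
      have "indicator Q (x - t *\<^sub>R ?e) * u x = indicator Q x * u x - indicator S' x * u x" for x
        using t by (auto simp: indicator_def Q_def S'_def axis_def)
      then show ?thesis
        using intb[OF Q, of 0] intb[of S' 0] by simp
    qed
    also have "(LINT x|lborel. indicator S' x * u x) = (LINT x|lborel. indicator S x * u x)"
    proof (rule integral_cong_AE)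
      have "negligible {x::plane. x $ 1 = a}"
        using negligible_standard_hyperplane[of "axis 1 1 :: plane" a]
        by (simp add: cart_eq_inner_axis axis_in_Basis_iff)
      then have "AE x in lebesgue. x \<notin> {x::plane. x $ 1 = a}"
        by (intro AE_not_in) (simp add: negligible_iff_null_sets)
      then have "AE x::plane in lborel. x $ 1 \<noteq> a"
        by (subst (asm) AE_completion_iff) auto
      then show "AE x in lborel. indicator S' x * u x = indicator S x * u x"
        by eventually_elim (auto simp: indicator_def S S'_def)
    qed (auto simp: S_def)
    also have "((LINT x|lborel. indicator Q x * u x) - (LINT x|lborel. indicator S x * u x)
        - (LINT x|lborel. indicator Q x * u x)) / t = - ((LINT x|lborel. indicator S x * u x) / t)"
      by simp
    finally have eq: "(LINT x|lborel. indicator Q x * ((u (x + t *\<^sub>R ?e) - u x) / t))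
        = - ((LINT x|lborel. indicator S x * u x) / t)" .
    have lower: "1 - M * t \<le> u x" if "x \<in> S" for x
    proof -
      define s where "s = x $ 1 - a"
      have s: "0 \<le> s" "s \<le> t"
        using that by (auto simp: s_def S)
      have "x - s *\<^sub>R ?e \<in> vertical_segment a c d"
        using that by (auto simp: vertical_segment_def S s_def axis_def)
      then have "1 \<le> u (x - s *\<^sub>R ?e)"
        by (rule one)
      moreover have "\<bar>u (x - s *\<^sub>R ?e + s *\<^sub>R ?e) - u (x - s *\<^sub>R ?e)\<bar> \<le> M * s"
        by (rule M(2)) (rule s)
      moreover have "M * s \<le> M * t"
        using s M by (intro mult_left_mono) auto
      ultimately show ?thesis
        by simp
    qed
    have mS: "measure lborel S = t * (d - c)"
      unfolding S_def using t cd by (subst content_cbox_cart) (auto simp: interval_ne_empty_cart forall_2 vector_2 UNIV_2)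
    have "(1 - M * t) * (t * (d - c)) = (LINT x|lborel. indicator S x * (1 - M * t))"
      using mS[unfolded S_def] by (simp add: S_def)
    also have "\<dots> \<le> (LINT x|lborel. indicator S x * u x)"
    proof (rule integral_mono)
      show "integrable lborel (\<lambda>x. indicator S x * (1 - M * t))"
        unfolding S_def by (intro integrable_mult_left integrable_real_indicator emeasure_bounded_finite) auto
      show "integrable lborel (\<lambda>x. indicator S x * u x)"
        using intb[of S 0] by (simp add: S_def)
    qed (use lower in \<open>auto simp: indicator_def\<close>)
    finally have "(d - c) * (1 - M * t) \<le> (LINT x|lborel. indicator S x * u x) / t"
      using t by (simp add: field_simps)
    then show ?thesis
      unfolding eq minus_mult_left[symmetric] by (simp only: neg_le_iff_le)
  qed
  have "(\<lambda>n. - (d - c) * (1 - M * inverse (real (Suc n)))) \<longlonglongrightarrow> - (d - c) * (1 - M * 0)"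
    by (intro tendsto_intros LIMSEQ_inverse_real_of_nat)
  then have "(LINT x|lborel. indicator Q x * partial 1 u x) \<le> - (d - c) * (1 - M * 0)"
    using lim by (intro LIMSEQ_le[OF lim]) (use step in auto)
  then show ?thesis
    by (simp add: Q_def)
qed

text \<open>The flux bound says that the integral of \<open>\<bar>partial 1 u\<bar>\<close> is at
  least \<open>d - c\<close>. Since \<open>u\<close> is supported in a ball of area
  \<open>b\<close>, Cauchy-Schwarz gives the Dirichlet integral the lower bound
  \<open>(d - c)\<^sup>2 / b\<close>, uniformly in \<open>u\<close>.\<close>

lemma capacity_vertical_segment_pos:
  assumes A: "bounded A" and cd: "c < d"
  shows "capacity A (vertical_segment a c d) > 0"
proof -
  obtain R where R: "R > 0" "\<And>x. x \<in> A \<Longrightarrow> norm x \<le> R"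
    using A by (auto simp: bounded_pos)
  define b where "b = measure lborel (cball 0 R :: plane set)"
  have b: "b > 0"
    unfolding b_def using R by (simp add: content_cball_pos)
  have "ennreal ((d - c)\<^sup>2 / b) \<le> (\<integral>\<^sup>+x\<in>A. ennreal ((norm (gradient u x))\<^sup>2) \<partial>lebesgue)"
    if u: "u \<in> test_functions A" and pos: "\<forall>x. 0 \<le> u x" and one: "\<forall>x\<in>vertical_segment a c d. 1 \<le> u x" for u
  proof -
    have [measurable]: "partial 1 u \<in> borel_measurable borel"
      using test_function_facts[OF u] by (auto intro: borel_measurable_continuous_onI)
    have z: "partial 1 u x = 0" if "x \<notin> A" for x
    proof -
      have x: "x \<in> - closure {x. u x \<noteq> 0}"
        using u that by (auto simp: test_functions_def)
      have "(u has_derivative (\<lambda>_. 0)) (at x)"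
      proof (rule has_derivative_transform_within_open[where f = "\<lambda>_. 0"])
        show "0 = u y" if "y \<in> - closure {x. u x \<noteq> 0}" for y
          using that closure_subset[of "{x. u x \<noteq> 0}"] by auto
      qed (use x in auto)
      then show ?thesis
        unfolding partial_def by (simp flip: frechet_derivative_at)
    qed
    obtain M where M: "\<And>x. \<bar>partial 1 u x\<bar> \<le> M"
      using test_function_lipschitz[OF u, of 1] by metis
    have zR: "partial 1 u x = 0" if "norm x \<ge> R + 1" for x
      using z[of x] R that by force
    define Q :: "plane set" where "Q = {x. a < x $ 1 \<and> c \<le> x $ 2 \<and> x $ 2 \<le> d}"
    have [measurable]: "Q \<in> sets borel"
      unfolding Q_def by measurable
    \<comment> \<open>Cauchy-Schwarz is replaced by the pointwise inequality
      \<open>\<bar>p\<bar> \<le> r / 2 + p\<^sup>2 / (2 * r)\<close>. With this \<open>r\<close> the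
      first term integrates to \<open>(d - c) / 2\<close>, half of the left-hand side.\<close>
    define r where "r = (d - c) / b"
    have r: "r > 0"
      using cd b by (simp add: r_def)
    define J where "J = (LINT x|lborel. (partial 1 u x)\<^sup>2)"
    have iJ: "integrable lborel (\<lambda>x. (partial 1 u x)\<^sup>2)"
      by (rule integrable_bounded_support[where B = "M\<^sup>2" and R = "R + 1"])
         (use zR power_mono[OF M, of _ 2] in auto)
    have iball: "integrable lborel (\<lambda>x. r / 2 * indicator (cball 0 R :: plane set) x)"
      by (intro integrable_mult_right integrable_real_indicator emeasure_bounded_finite) auto
    have "d - c \<le> (LINT x|lborel. - (indicator Q x * partial 1 u x))"
      using flux_right_of_segment[OF u, of a c d] pos one cd by (simp add: Q_def)
    also have "\<dots> \<le> (LINT x|lborel. r / 2 * indicator (cball 0 R) x + (partial 1 u x)\<^sup>2 / (2 * r))"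
    proof (rule integral_mono)
      show "integrable lborel (\<lambda>x. - (indicator Q x * partial 1 u x))"
        by (rule integrable_bounded_support[where B = "M" and R = "R + 1"])
           (use zR M order_trans[OF abs_ge_zero M] in \<open>auto simp: indicator_def\<close>)
      show "integrable lborel (\<lambda>x. r / 2 * indicator (cball 0 R) x + (partial 1 u x)\<^sup>2 / (2 * r))"
        using iJ iball by auto
      fix x
      have "- (indicator Q x * partial 1 u x) \<le> \<bar>partial 1 u x\<bar>"
        by (auto simp: indicator_def)
      also have "\<dots> \<le> r / 2 * indicator (cball 0 R) x + (partial 1 u x)\<^sup>2 / (2 * r)"
      proof (cases "x \<in> A")
        case True
        have "0 \<le> (\<bar>partial 1 u x\<bar> - r)\<^sup>2"
          by simp
        then have "2 * r * \<bar>partial 1 u x\<bar> \<le> r\<^sup>2 + (partial 1 u x)\<^sup>2"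
          by (simp add: power2_diff algebra_simps)
        then have "\<bar>partial 1 u x\<bar> \<le> (r\<^sup>2 + (partial 1 u x)\<^sup>2) / (2 * r)"
          using r by (simp add: field_simps)
        then show ?thesis
          using R(2)[OF True] r by (simp add: add_divide_distrib power2_eq_square)
      qed (use z r in \<open>auto simp: indicator_def\<close>)
      finally show "- (indicator Q x * partial 1 u x)
          \<le> r / 2 * indicator (cball 0 R) x + (partial 1 u x)\<^sup>2 / (2 * r)" .
    qed
    also have "\<dots> = r / 2 * b + J / (2 * r)"
      using iJ iball by (simp add: J_def b_def)
    also have "r / 2 * b = (d - c) / 2"
      using b by (simp add: r_def)
    finally have le: "d - c \<le> (d - c) / 2 + J / (2 * r)" .
    have "p / 2 \<le> q" if "p \<le> p / 2 + q" for p q :: real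
      using that by linarith
    then have "(d - c) / 2 \<le> J / (2 * r)"
      using le .
    then have "(d - c)\<^sup>2 / b \<le> J"
      using r b by (simp add: r_def field_simps power2_eq_square)
    then have "ennreal ((d - c)\<^sup>2 / b) \<le> ennreal J"
      by (rule ennreal_leI)
    also have "\<dots> = (\<integral>\<^sup>+x. ennreal ((partial 1 u x)\<^sup>2) \<partial>lborel)"
      unfolding J_def by (rule nn_integral_eq_integral[symmetric, OF iJ]) auto
    also have "\<dots> \<le> (\<integral>\<^sup>+x. ennreal ((norm (gradient u x))\<^sup>2) * indicator A x \<partial>lborel)"
    proof (rule nn_integral_mono)
      fix x
      have "\<bar>partial 1 u x\<bar> \<le> norm (gradient u x)"
        using component_le_norm_cart[of "gradient u x" 1] by (simp add: gradient_def)
      then have "(partial 1 u x)\<^sup>2 \<le> (norm (gradient u x))\<^sup>2"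
        by (metis abs_ge_zero power2_abs power_mono)
      then show "ennreal ((partial 1 u x)\<^sup>2) \<le> ennreal ((norm (gradient u x))\<^sup>2) * indicator A x"
        using z[of x] by (auto simp: indicator_def intro: ennreal_leI)
    qed
    finally show ?thesis
      by (simp add: nn_integral_completion)
  qed
  then have "ennreal ((d - c)\<^sup>2 / b) \<le> capacity A (vertical_segment a c d)"
    unfolding capacity_def by (intro INF_greatest) auto
  moreover have "0 < ennreal ((d - c)\<^sup>2 / b)"
    using b cd by simp
  ultimately show ?thesis
    by (rule order_less_le_trans[rotated])
qed

lemma not_zero_capacity_vertical_segment:
  assumes "vertical_segment a c d \<subseteq> S" "c < d"
  shows "\<not> zero_capacity S"
proof
  assume "zero_capacity S"
  then have "compact_zero_capacity (vertical_segment a c d)"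
    using assms compact_vertical_segment by (auto simp: zero_capacity_def)
  then obtain A where "bounded A" "capacity A (vertical_segment a c d) = 0"
    using vertical_segment_nonempty[of c d a] assms(2) by (auto simp: compact_zero_capacity_def)
  then show False
    using capacity_vertical_segment_pos[OF \<open>bounded A\<close> assms(2), of a] by simp
qed

section \<open>Preimages under z + exp (- i z)\<close>

definition expmap :: "complex \<Rightarrow> complex" where
  "expmap z = z + exp (- \<i> * z)"

text \<open>Each preimage under \<open>expmap\<close> below is found by rewriting
  \<open>expmap z = w\<close> as a fixed point equation whose derivative is at most 1/2 on a
  suitable convex set.\<close>

lemma contraction_fixpoint:
  fixes T :: "complex \<Rightarrow> complex"
  assumes "closed S" "convex S" "S \<noteq> {}" "T ` S \<subseteq> S"
    and "\<And>z. z \<in> S \<Longrightarrow> (T has_field_derivative T' z) (at z)"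
    and "\<And>z. z \<in> S \<Longrightarrow> norm (T' z) \<le> 1/2"
  obtains z where "z \<in> S" "T z = z"
proof -
  have "dist (T x) (T y) \<le> 1/2 * dist x y" if "x \<in> S" "y \<in> S" for x y
    unfolding dist_norm using assms that
    by (intro field_differentiable_bound[of S T T' "1/2"]) (auto intro: has_field_derivative_at_within)
  then have "\<exists>!x\<in>S. T x = x"
    using assms by (intro Banach_fix[of S "1/2"]) (auto simp: complete_eq_closed)
  then show thesis
    using that by blast
qed

text \<open>On the line Re z = - pi/2, exp (- i z) equals i e^y, so the derivative of
  \<open>expmap\<close> there is the positive number 1 + e^y. A quantitative inverse function
  theorem turns this into covering of a disc larger by the factor e^y / 2.\<close>

lemma expmap_expanding_near_ray:
  assumes y: "y \<ge> 0" and r: "0 \<le> r" "r \<le> 1/4"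
    and w: "w \<in> cball (expmap (Complex (- pi/2) y)) (r * exp y / 2)"
  obtains z where "z \<in> cball (Complex (- pi/2) y) r" "expmap z = w"
proof -
  define p where "p = Complex (- pi/2) y"
  define E where "E = exp y"
  have E: "E \<ge> 1"
    using y by (simp add: E_def)
  have exp_p: "exp (- \<i> * p) = \<i> * of_real E"
    by (simp add: p_def E_def exp_eq_polar complex_eq_iff Re_exp Im_exp)
  define v where "v = w - expmap p"
  have v: "norm v \<le> r * E / 2"
    using w by (simp add: v_def p_def E_def dist_norm norm_minus_commute)
  \<comment> \<open>Newton iteration for \<open>expmap (p + h) = w\<close> with the derivative
    frozen at its value \<open>1 + E\<close> at \<open>p\<close>; the bracket is the nonlinear part
    of the exponential.\<close>
  define T where "T h = (v - \<i> * E * (exp (- \<i> * h) - 1 + \<i> * h)) / (1 + E)" for h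
  define T' where "T' h = - \<i> * E * (- \<i> * exp (- \<i> * h) + \<i>) / (1 + E)" for h
  have E1: "(1 + complex_of_real E) \<noteq> 0"
    using E by (metis of_real_1 of_real_add of_real_eq_0_iff add_nonneg_eq_0_iff zero_le_one order_trans zero_neq_one)
  have nE1: "norm (1 + complex_of_real E) = 1 + E"
    using E by (metis norm_of_real of_real_1 of_real_add abs_of_nonneg add_nonneg_nonneg order_trans zero_le_one)
  have T': "(T has_field_derivative T' h) (at h)" for h
    unfolding T_def T'_def by (rule derivative_eq_intros refl E1 | simp add: E1)+
  have ex: "norm (exp (- \<i> * h) - 1) \<le> 13/40" if "norm h \<le> r" for h :: complex
  proof -
    have n: "norm (- \<i> * h) \<le> 1/4"
      using that r by (simp add: norm_mult)
    have e: "exp (1/4::real) \<le> 13/10"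
    proof -
      have "exp (1/4::real) ^ 4 = exp 1"
        by (simp flip: exp_of_nat_mult)
      also have "\<dots> \<le> (13/10)^4"
        using e_less_272 by (simp add: power4_eq_xxxx)
      finally show ?thesis
        by (subst (asm) power_mono_iff) auto
    qed
    have "norm (exp (- \<i> * h) - 1) \<le> exp (norm (- \<i> * h)) * norm (- \<i> * h)"
      using Taylor_exp_field[of "- \<i> * h" 0] by simp
    also have "\<dots> \<le> exp (1/4) * (1/4)"
      using n by (intro mult_mono) auto
    also have "\<dots> \<le> 13/10 * (1/4)"
      using e by (intro mult_right_mono) auto
    finally show ?thesis by simp
  qed
  have T'b: "norm (T' h) \<le> 13/40" if "norm h \<le> r" for h :: complex
  proof -
    have "- \<i> * E * (- \<i> * exp (- \<i> * h) + \<i>) = - complex_of_real E * (exp (- \<i> * h) - 1)"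
      by (simp add: algebra_simps)
    then have "T' h = - complex_of_real E * (exp (- \<i> * h) - 1) / (1 + complex_of_real E)"
      unfolding T'_def by simp
    then have "norm (T' h) = E / (1 + E) * norm (exp (- \<i> * h) - 1)"
      using E by (simp add: norm_mult norm_divide nE1)
    also have "\<dots> \<le> 1 * (13/40)"
      using E ex[OF that] by (intro mult_mono) auto
    finally show ?thesis by simp
  qed
  have T0: "T 0 = v / (1 + E)"
    by (simp add: T_def)
  \<comment> \<open>\<open>T 0\<close> uses up \<open>r / 2\<close> of the radius and the
    contraction \<open>13/40 * r\<close>, together less than \<open>r\<close>. The constant 13/40 is
    1/4 times 13/10, an upper bound for \<open>exp (1/4)\<close>.\<close>
  have self: "T ` cball 0 r \<subseteq> cball 0 r"
  proof safe
    fix h :: complex assume h: "h \<in> cball 0 r"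
    have "norm (T h - T 0) \<le> 13/40 * norm (h - 0)"
      using h T' T'b r by (intro field_differentiable_bound[of "cball 0 r" T T'])
        (auto intro: has_field_derivative_at_within)
    also have "\<dots> \<le> 13/40 * r"
      using h by simp
    finally have 1: "norm (T h - T 0) \<le> 13/40 * r" .
    have "norm (T 0) = norm v / (1 + E)"
      by (simp add: T0 norm_divide nE1)
    also have "\<dots> \<le> r / 2"
      using v E r by (simp add: field_simps)
    finally have "norm (T h) \<le> 13/40 * r + r / 2"
      using 1 norm_triangle_ineq[of "T h - T 0" "T 0"] by simp
    then show "T h \<in> cball 0 r"
      using r by simp
  qed
  obtain h where h: "h \<in> cball 0 r" "T h = h"
  proof (rule contraction_fixpoint[of "cball 0 r" T T'])
    show "norm (T' z) \<le> 1/2" if "z \<in> cball 0 r" for z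
      using T'b[of z] that by simp
  qed (use r self T' in auto)
  have "v - \<i> * E * (exp (- \<i> * h) - 1 + \<i> * h) = h * (1 + E)"
    using h(2) E1 by (simp add: T_def field_simps)
  then have "v = h + \<i> * E * (exp (- \<i> * h) - 1)"
    by (simp add: algebra_simps)
  moreover have "expmap (p + h) = expmap p + h + \<i> * E * (exp (- \<i> * h) - 1)"
  proof -
    have "exp (- \<i> * (p + h)) = exp (- \<i> * p) * exp (- \<i> * h)"
      by (simp add: exp_add[symmetric] algebra_simps)
    then show ?thesis
      using exp_p by (simp add: expmap_def algebra_simps)
  qed
  moreover have "w = expmap p + v"
    by (simp add: v_def)
  ultimately have "expmap (p + h) = w"
    by (simp add: add.assoc)
  moreover have "p + h \<in> cball p r"
    using h by (simp add: dist_norm)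
  ultimately show thesis
    using that by (simp add: p_def)
qed

lemma expmap_ray: "expmap (Complex (- pi/2) y) = Complex (- pi/2) (y + exp y)"
  by (simp add: expmap_def complex_eq_iff Re_exp Im_exp)

lemma ln_le_half: "x > 0 \<Longrightarrow> ln x \<le> x / 2" for x :: real
proof -
  assume x: "x > 0"
  have "ln (x / 2) \<le> x / 2 - 1"
    using x by (intro ln_le_minus_one) auto
  moreover have "ln (2::real) \<le> 1"
    using ln_le_minus_one[of "2::real"] by simp
  ultimately show ?thesis
    using x by (simp add: ln_div)
qed

text \<open>Solve \<open>z = \<i> Ln (w - z) - 2 \<pi> n\<close> by iteration in a left half-plane, where \<open>w - z\<close> avoids the branch cut.\<close>

lemma expmap_preimage_left:
  fixes n :: nat
  assumes n: "real n \<ge> norm w + 4"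
  obtains z where "expmap z = w" "Im z \<ge> 0" "norm z \<ge> real n" "norm z \<le> 13 * real n + 4 + norm w"
proof -
  \<comment> \<open>The margin 2 gives \<open>norm (w - z) \<ge> 2\<close>, hence a derivative of
    \<open>T\<close> of norm at most 1/2.\<close>
  define S where "S = {z. Re z \<le> Re w - 2}"
  define T where "T z = \<i> * Ln (w - z) - of_real (2 * pi * n)" for z
  have S: "Re (w - z) \<ge> 2" "w - z \<notin> \<real>\<^sub>\<le>\<^sub>0" "norm (w - z) \<ge> 2" if "z \<in> S" for z
    using that abs_Re_le_cmod[of "w - z"] by (auto simp: S_def complex_nonpos_Reals_iff)
  have "closed S"
    unfolding S_def by (intro closed_Collect_le continuous_intros)
  have "convex S"
    unfolding S_def by (rule convex_halfspace_Re_le)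
  have Re: "\<bar>Re (T z) + 2 * pi * n\<bar> \<le> pi / 2" if "z \<in> S" for z
    using S[OF that] Re_Ln_pos_le[of "w - z"] by (cases "w = z") (auto simp: T_def)
  obtain z where z: "z \<in> S" "T z = z"
  proof (rule contraction_fixpoint[of S T "\<lambda>z. - \<i> / (w - z)"])
    show "S \<noteq> {}"
      by (auto simp: S_def intro!: exI[of _ "w - 2"])
    show "T ` S \<subseteq> S"
    proof safe
      fix z assume "z \<in> S"
      from Re[OF this] have "Re (T z) \<le> pi / 2 - 2 * pi * n"
        by linarith
      also have "\<dots> \<le> 2 - 6 * real n"
      proof -
        have "3 * real n \<le> pi * real n"
          using pi_gt3 by (intro mult_right_mono) auto
        then show ?thesis
          using pi_less_4 by linarith
      qed
      also have "\<dots> \<le> Re w - 2"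
        using n abs_Re_le_cmod[of w] by linarith
      finally show "T z \<in> S"
        by (simp add: S_def)
    qed
    show "(T has_field_derivative - \<i> / (w - z)) (at z)" if "z \<in> S" for z
      unfolding T_def using S[OF that]
      by (auto intro!: derivative_eq_intros simp: field_simps)
    show "norm (- \<i> / (w - z)) \<le> 1/2" if "z \<in> S" for z
      using S(3)[OF that] by (auto simp: norm_divide divide_le_eq)
  qed (use \<open>closed S\<close> \<open>convex S\<close> in auto)
  have nz: "w - z \<noteq> 0"
    using S(3)[OF z(1)] by auto
  have "exp (- \<i> * z) = exp (- \<i> * T z)"
    using z by simp
  also have "- \<i> * T z = Ln (w - z) + of_int (int n) * (of_real (2 * pi) * \<i>)"
    by (simp add: T_def algebra_simps)
  also have "exp \<dots> = w - z"
    using nz by (simp add: exp_add exp_integer_2pi[of "of_int (int n)", simplified] mult.commute mult.left_commute)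
  finally have "expmap z = w"
    by (simp add: expmap_def)
  moreover have Imz: "Im z = ln (norm (w - z))"
  proof -
    have "Im (T z) = ln (norm (w - z))"
      using nz by (simp add: T_def)
    then show ?thesis using z by simp
  qed
  then have "Im z \<ge> 0"
    using S(3)[OF z(1)] by simp
  moreover have pn: "3 * real n \<le> pi * real n" "pi * real n \<le> 63/20 * real n"
  proof -
    have "pi \<le> 63/20"
      using pi_approx by simp
    then show "3 * real n \<le> pi * real n" "pi * real n \<le> 63/20 * real n"
      using pi_gt3 by (intro mult_right_mono; linarith)+
  qed
  have Rez: "\<bar>Re z + 2 * (pi * n)\<bar> \<le> pi / 2"
    using Re[OF z(1)] z by (simp add: mult.assoc)
  then have "norm z \<ge> real n"
    using abs_Re_le_cmod[of z] pn n pi_less_4 norm_ge_zero[of w] by linarith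
  moreover have "norm z \<le> 13 * real n + 4 + norm w"
  proof -
    \<comment> \<open>The logarithm is bounded linearly with slope 1/2, so that only half of
      \<open>norm z\<close> appears on the right and can be absorbed. The factor 13 of the lemma
      then bounds 4 pi.\<close>
    have "Im z \<le> norm (w - z) / 2"
      unfolding Imz using nz by (intro ln_le_half) auto
    also have "\<dots> \<le> norm w / 2 + norm z / 2"
      using norm_triangle_ineq4[of w z] by simp
    finally have "\<bar>Im z\<bar> \<le> norm w / 2 + norm z / 2"
      using \<open>Im z \<ge> 0\<close> by simp
    moreover have "norm z \<le> \<bar>Re z\<bar> + \<bar>Im z\<bar>"
      by (rule cmod_le)
    moreover have "\<bar>Re z\<bar> \<le> pi / 2 + 2 * (pi * n)"
      using Rez mult_nonneg_nonneg[OF pi_ge_zero of_nat_0_le_iff[of n]] by linarith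
    ultimately have "norm z \<le> pi + 4 * (pi * n) + norm w"
      by linarith
    then show ?thesis
      using pn pi_less_4 by linarith
  qed
  ultimately show thesis
    using that by blast
qed

text \<open>For z small compared with w, the equation is nearly exp (- i z) = w, with solution
  \<open>c = \<i> * Ln w\<close>. Since Re c = - Arg w lies within 3 pi/2 of - pi/2, and Im c =
  \<open>ln (norm w)\<close> within 2 of \<open>Y\<close>, \<open>c\<close> is within 7 of the
  centre; the remaining 1 is the radius of the ball on which the correction is found.\<close>

lemma expmap_preimage_annulus:
  assumes w: "norm w \<ge> 100" and Y: "\<bar>ln (norm w) - Y\<bar> \<le> 2"
  obtains z where "expmap z = w" "Im z \<ge> 0" "z \<in> cball (Complex (- pi/2) Y) 8"
proof -
  define c where "c = \<i> * Ln w"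
  have w0: "w \<noteq> 0"
    using w by auto
  have "norm c \<le> norm w / 4"
  proof -
    have "norm c \<le> \<bar>ln (norm w)\<bar> + pi"
      using cmod_le[of "Ln w"] w0 mpi_less_Im_Ln[OF w0] Im_Ln_le_pi[OF w0]
      by (simp add: c_def norm_mult)
    moreover have "ln (norm w) \<ge> 0"
      using w by simp
    moreover have "ln (norm w) \<le> norm w / 8 + 7"
    proof -
      have "ln (norm w / 8) \<le> norm w / 8 - 1"
        using w by (intro ln_le_minus_one) auto
      moreover have "ln (8::real) \<le> 7"
        using ln_le_minus_one[of "8::real"] by simp
      ultimately show ?thesis
        using w w0 by (simp add: ln_div)
    qed
    ultimately show ?thesis
      using w pi_less_4 by linarith
  qed
  \<comment> \<open>Ln (w - z) is split as Ln w + Ln (1 - z / w): the variable occurs only in the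
    second logarithm, which stays near 1, so \<open>w\<close> itself may lie on the branch
    cut.\<close>
  define T where "T z = c + \<i> * Ln (1 - z / w)" for z
  have S: "norm (z / w) < 1/2" "Re (1 - z / w) > 0" "norm (w - z) \<ge> 2" "1 - z / w \<notin> \<real>\<^sub>\<le>\<^sub>0" if "z \<in> cball c 1" for z
  proof -
    have "norm z \<le> norm c + 1"
      using that norm_triangle_ineq3[of z c] by (simp add: dist_norm norm_minus_commute)
    then have z: "norm z < norm w / 2"
      using w \<open>norm c \<le> norm w / 4\<close> by linarith
    then show 1: "norm (z / w) < 1/2"
      using w0 by (simp add: norm_divide field_simps)
    show 2: "Re (1 - z / w) > 0"
      using 1 abs_Re_le_cmod[of "z / w"] by (simp add: abs_le_iff)
    show "norm (w - z) \<ge> 2"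
      using z w norm_triangle_ineq2[of w z] by linarith
    show "1 - z / w \<notin> \<real>\<^sub>\<le>\<^sub>0"
      using 2 by (auto simp: complex_nonpos_Reals_iff)
  qed
  obtain z where z: "z \<in> cball c 1" "T z = z"
  proof (rule contraction_fixpoint[of "cball c 1" T "\<lambda>z. - \<i> / (w - z)"])
    show "T ` cball c 1 \<subseteq> cball c 1"
    proof safe
      fix z assume z: "z \<in> cball c 1"
      have "norm (Ln (1 + (- (z / w)))) \<le> 2 * norm (- (z / w))"
        using S(1)[OF z] by (intro norm_Ln_le) auto
      then show "T z \<in> cball c 1"
        using S(1)[OF z] by (simp add: T_def dist_norm norm_mult)
    qed
    show "(T has_field_derivative - \<i> / (w - z)) (at z)" if "z \<in> cball c 1" for z
    proof -
      have "w - z \<noteq> 0"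
        using S(3)[OF that] by auto
      then show ?thesis
        unfolding T_def using S(4)[OF that] w0
        by (auto intro!: derivative_eq_intros simp: field_simps)
    qed
    show "norm (- \<i> / (w - z)) \<le> 1/2" if "z \<in> cball c 1" for z
      using S(3)[OF that] by (auto simp: norm_divide divide_le_eq)
  qed auto
  have nz: "1 - z / w \<noteq> 0"
    using S(2)[OF z(1)] by auto
  have "exp (- \<i> * z) = exp (- \<i> * T z)"
    using z by simp
  also have "- \<i> * T z = Ln w + Ln (1 - z / w)"
    by (simp add: T_def c_def algebra_simps)
  also have "exp \<dots> = w - z"
    using nz w0 by (simp add: exp_add field_simps)
  finally have "expmap z = w"
    by (simp add: expmap_def)
  moreover have "\<bar>Im z - Im c\<bar> \<le> 1"
    using z(1) abs_Im_le_cmod[of "z - c"] by (simp add: dist_norm norm_minus_commute)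
  then have "Im z \<ge> 0"
  proof -
    have "1 \<le> ln (norm w)"
      using w e_less_272 by (subst ln_ge_iff) auto
    then show ?thesis
      using \<open>\<bar>Im z - Im c\<bar> \<le> 1\<close> w0 by (simp add: c_def)
  qed
  moreover have "z \<in> cball (Complex (- pi/2) Y) 8"
  proof -
    have "norm (c - Complex (- pi/2) Y) \<le> \<bar>- Im (Ln w) + pi / 2\<bar> + \<bar>ln (norm w) - Y\<bar>"
      using cmod_le[of "c - Complex (- pi/2) Y"] w0 by (simp add: c_def)
    also have "\<dots> \<le> 3 * pi / 2 + 2"
      using Y mpi_less_Im_Ln[OF w0] Im_Ln_le_pi[OF w0] by linarith
    also have "\<dots> \<le> 7"
      using pi_approx by simp
    finally show ?thesis
      using z(1) norm_triangle_ineq[of "z - c" "c - Complex (- pi/2) Y"]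
      by (simp add: dist_norm norm_minus_commute)
  qed
  ultimately show thesis
    using that by blast
qed

section \<open>Slow convergence with oscillating displacement\<close>

text \<open>The quadratic tangency to the identity at 0 gives the slow convergence. The factor
  \<open>1 - u\<close> makes 1 a fixed point as well, so that the strip can be glued to the identity
  on both sides.\<close>

definition drift :: "real \<Rightarrow> real" where
  "drift u = u - u\<^sup>2 * (1 - u) / 2"

text \<open>The amplitude grows linearly, while the logarithm slows the oscillation so much that the
  derivative is bounded and again Lipschitz. The latter is needed for bounding
  \<open>slide'\<close>.\<close>

definition wave :: "real \<Rightarrow> real" where
  "wave L = (1 + L) * sin (ln (1 + L))"

definition wave' :: "real \<Rightarrow> real" where
  "wave' L = sin (ln (1 + L)) + cos (ln (1 + L))"

lemma drift_eq: "drift u = u * (1 - u * (1 - u) / 2)"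
  by (simp add: drift_def power2_eq_square algebra_simps)

lemma drift_factor:
  fixes u :: real
  shows "1 - u * (1 - u) / 2 \<ge> 7/8"
proof -
  have "0 \<le> (u - 1/2)\<^sup>2"
    by simp
  then have "u * (1 - u) \<le> 1/4"
    by (simp add: power2_diff power2_eq_square algebra_simps)
  then show ?thesis
    by linarith
qed

lemma drift_bounds:
  assumes "0 < u" "u < 1"
  shows "0 < drift u" "drift u < u" "drift u < 1"
proof -
  show "0 < drift u"
    unfolding drift_eq using assms drift_factor[of u] by (intro mult_pos_pos) auto
  have "u\<^sup>2 * (1 - u) > 0"
    using assms by simp
  then show "drift u < u"
    unfolding drift_def by linarith
  then show "drift u < 1"
    using assms by linarith
qed

lemma ln_drift:
  assumes "0 < u" "u < 1"
  shows "0 \<le> ln u - ln (drift u)" "ln u - ln (drift u) \<le> u * (1 - u)"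
proof -
  define q where "q = 1 - u * (1 - u) / 2"
  have q: "q \<ge> 7/8" "q > 0"
    using drift_factor[of u] by (auto simp: q_def)
  have eq: "ln u - ln (drift u) = ln (inverse q)"
    unfolding drift_eq q_def[symmetric] using assms q by (simp add: ln_mult ln_inverse)
  show "0 \<le> ln u - ln (drift u)"
    using drift_bounds[OF assms] assms by simp
  have "ln (inverse q) \<le> inverse q - 1"
    using q by (intro ln_le_minus_one) auto
  also have "\<dots> = u * (1 - u) / 2 / q"
    using q by (simp add: q_def field_simps)
  also have "\<dots> \<le> u * (1 - u) / 2 / (1/2)"
    using q assms by (intro divide_left_mono) auto
  finally show "ln u - ln (drift u) \<le> u * (1 - u)"
    using eq by simp
qed

text \<open>The orbits of \<open>drift\<close> behave like \<open>2 / n\<close>. Along an orbit, \<open>- ln u\<close> tends to infinity with bounded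
  increments, and \<open>wave\<close> is Lipschitz but oscillates unboundedly at infinity.\<close>

lemma wave_has_derivative:
  assumes "L \<ge> 0"
  shows "(wave has_real_derivative wave' L) (at L)"
proof -
  have "1 + L \<noteq> 0" "1 + L > 0"
    using assms by auto
  then show ?thesis
    unfolding wave_def wave'_def by (auto intro!: derivative_eq_intros)
qed

lemma abs_wave'_le: "\<bar>wave' L\<bar> \<le> 2"
  using abs_sin_le_one[of "ln (1 + L)"] abs_cos_le_one[of "ln (1 + L)"]
  unfolding wave'_def by linarith

lemma wave_lipschitz:
  assumes "L \<ge> 0" "M \<ge> 0"
  shows "\<bar>wave L - wave M\<bar> \<le> 2 * \<bar>L - M\<bar>"
proof -
  have "norm (wave L - wave M) \<le> 2 * norm (L - M)"
    by (rule field_differentiable_bound[of "{0..}" wave wave'])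
      (use assms wave_has_derivative abs_wave'_le in \<open>auto intro: has_field_derivative_at_within\<close>)
  then show ?thesis by simp
qed

lemma wave'_lipschitz:
  assumes "L \<ge> 0" "M \<ge> 0"
  shows "\<bar>wave' L - wave' M\<bar> \<le> 2 * \<bar>L - M\<bar>"
proof -
  have "norm (wave' L - wave' M) \<le> 2 * norm (L - M)"
  proof (rule field_differentiable_bound[of "{0..}" wave' "\<lambda>L. (cos (ln (1 + L)) - sin (ln (1 + L))) / (1 + L)"])
    fix K :: real assume K: "K \<in> {0..}"
    show "(wave' has_real_derivative (cos (ln (1 + K)) - sin (ln (1 + K))) / (1 + K)) (at K within {0..})"
      unfolding wave'_def using K by (auto intro!: derivative_eq_intros simp: diff_divide_distrib)
    have "\<bar>cos (ln (1 + K)) - sin (ln (1 + K))\<bar> \<le> 2"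
      using abs_sin_le_one[of "ln (1 + K)"] abs_cos_le_one[of "ln (1 + K)"] by linarith
    also have "\<dots> \<le> 2 * (1 + K)"
      using K by simp
    finally show "norm ((cos (ln (1 + K)) - sin (ln (1 + K))) / (1 + K)) \<le> 2"
      using K by (simp add: field_simps)
  qed (use assms in auto)
  then show ?thesis by simp
qed

text \<open>A coboundary, so that the horizontal displacements telescope along orbits; its derivative stays bounded
  as \<open>u\<close> tends to \<open>0\<close> because \<open>drift u = u + O(u\<^sup>2)\<close>.\<close>

definition slide :: "real \<Rightarrow> real" where
  "slide u = wave (- ln (drift u)) - wave (- ln u)"

definition slide' :: "real \<Rightarrow> real" where
  "slide' u = wave' (- ln u) / u - wave' (- ln (drift u)) * (1 - u + 3/2 * u\<^sup>2) / drift u"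

lemma drift_has_derivative: "(drift has_real_derivative 1 - u + 3/2 * u\<^sup>2) (at u)"
  unfolding drift_def by (auto intro!: derivative_eq_intros simp: power2_eq_square field_simps)

lemma slide_has_derivative:
  assumes "0 < u" "u < 1"
  shows "(slide has_real_derivative slide' u) (at u)"
proof -
  note d = drift_bounds[OF assms]
  have 1: "((\<lambda>u. - ln (drift u)) has_real_derivative - ((1 - u + 3/2 * u\<^sup>2) / drift u)) (at u)"
    using d by (auto intro!: derivative_eq_intros drift_has_derivative)
  have 2: "((\<lambda>u. - ln u) has_real_derivative - (1 / u)) (at u)"
    using assms by (auto intro!: derivative_eq_intros)
  have "(wave has_real_derivative wave' (- ln (drift u))) (at (- ln (drift u)))"
    "(wave has_real_derivative wave' (- ln u)) (at (- ln u))"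
    using d assms by (auto intro!: wave_has_derivative)
  from DERIV_chain2[OF this(1) 1] DERIV_chain2[OF this(2) 2] show ?thesis
    unfolding slide_def slide'_def by (auto intro!: derivative_eq_intros)
qed

text \<open>The bound vanishes at both edges of the strip; the continuity of \<open>shift\<close>
  rests on this.\<close>

lemma abs_slide_le:
  assumes "0 < u" "u < 1"
  shows "\<bar>slide u\<bar> \<le> 2 * (u * (1 - u))"
proof -
  have "\<bar>slide u\<bar> \<le> 2 * \<bar>- ln (drift u) - - ln u\<bar>"
    unfolding slide_def using drift_bounds[OF assms] assms by (intro wave_lipschitz) auto
  then show ?thesis
    using ln_drift[OF assms] by simp
qed

text \<open>Both terms of \<open>slide'\<close> are of size 1/u, but they cancel. The arguments of
  \<open>wave'\<close> differ by O(u), so its values do too, and the logarithmic derivative of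
  \<open>drift\<close> differs from 1/u by the bounded quantity
  \<open>(1/2 - u) / q\<close>.\<close>

lemma abs_slide'_le:
  assumes u: "0 < u" "u < 1"
  shows "\<bar>slide' u\<bar> \<le> 4"
proof -
  define q where "q = 1 - u * (1 - u) / 2"
  have q: "q \<ge> 7/8" "q > 0"
    using drift_factor[of u] by (auto simp: q_def)
  have dq: "drift u = u * q"
    by (simp add: drift_eq q_def)
  define W where "W = wave' (- ln (drift u))"
  have "slide' u = (wave' (- ln u) - W) / u + W * ((1/2 - u) / q)"
  proof -
    have "(1 - u + 3/2 * u\<^sup>2) / drift u = 1 / u - (1/2 - u) / q"
    proof -
      have "1 - u + 3/2 * u\<^sup>2 = q - u * (1/2 - u)"
        by (simp add: q_def power2_eq_square field_simps)
      then show ?thesis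
        using u q by (simp add: dq diff_divide_distrib)
    qed
    then have "slide' u = wave' (- ln u) / u - W * (1 / u - (1/2 - u) / q)"
      unfolding slide'_def W_def times_divide_eq_right[symmetric] by simp
    then show ?thesis
      by (simp add: algebra_simps diff_divide_distrib)
  qed
  moreover have "\<bar>(wave' (- ln u) - W) / u\<bar> \<le> 2"
  proof -
    have "\<bar>wave' (- ln u) - W\<bar> \<le> 2 * \<bar>- ln u - - ln (drift u)\<bar>"
      unfolding W_def using drift_bounds[OF u] u by (intro wave'_lipschitz) auto
    also have "\<dots> \<le> 2 * (u * (1 - u))"
      using ln_drift[OF u] by simp
    also have "\<dots> \<le> 2 * u"
      using u by simp
    finally show ?thesis
      using u by (simp add: field_simps)
  qed
  moreover have "\<bar>W * ((1/2 - u) / q)\<bar> \<le> 2"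
  proof -
    have "\<bar>(1/2 - u) / q\<bar> \<le> 1"
      using u q by (simp add: abs_le_iff field_simps)
    then have "\<bar>W\<bar> * \<bar>(1/2 - u) / q\<bar> \<le> 2 * 1"
      using abs_wave'_le[of "- ln (drift u)"] by (intro mult_mono) (auto simp: W_def)
    then show ?thesis by (simp add: abs_mult)
  qed
  ultimately show ?thesis
    by linarith
qed

lemma drift_derivative_bounds:
  fixes u :: real
  assumes "0 < u" "u < 1"
  shows "5/6 \<le> 1 - u + 3/2 * u\<^sup>2" "1 - u + 3/2 * u\<^sup>2 \<le> 3/2"
proof -
  have "0 \<le> (u - 1/3)\<^sup>2"
    by simp
  then show "5/6 \<le> 1 - u + 3/2 * u\<^sup>2"
    by (simp add: power2_diff power2_eq_square algebra_simps)
  have "u\<^sup>2 \<le> u"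
    using assms by (simp add: power2_eq_square)
  then show "1 - u + 3/2 * u\<^sup>2 \<le> 3/2"
    using assms by linarith
qed

lemma drift_funpow_bounds:
  assumes "0 < u" "u < 1"
  shows "0 < (drift ^^ n) u \<and> (drift ^^ n) u < 1"
  by (induction n) (use assms drift_bounds in auto)

lemma drift_funpow_tendsto_0:
  assumes u: "0 < u" "u < 1"
  shows "(\<lambda>n. (drift ^^ n) u) \<longlonglongrightarrow> 0"
proof -
  note b = drift_funpow_bounds[OF u]
  have dec: "decseq (\<lambda>n. (drift ^^ n) u)"
    by (rule decseq_SucI) (use drift_bounds b in \<open>auto intro: less_imp_le\<close>)
  obtain l where l: "(\<lambda>n. (drift ^^ n) u) \<longlonglongrightarrow> l"
    using decseq_convergent[OF dec, of 0] b by (metis less_imp_le)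
  have "0 \<le> l"
    by (rule LIMSEQ_le_const[OF l]) (use b in \<open>auto intro: less_imp_le\<close>)
  have "l \<le> u"
    by (rule LIMSEQ_le_const2[OF l]) (use decseqD[OF dec, of 0] in auto)
  have "(\<lambda>n. drift ((drift ^^ n) u)) \<longlonglongrightarrow> drift l"
    by (rule isCont_tendsto_compose[OF DERIV_isCont[OF drift_has_derivative] l])
  moreover have "(\<lambda>n. drift ((drift ^^ n) u)) \<longlonglongrightarrow> l"
    using LIMSEQ_Suc[OF l] by simp
  ultimately have "drift l = l"
    by (rule LIMSEQ_unique)
  then have "l = 0"
    using \<open>l \<le> u\<close> u by (auto simp: drift_def)
  with l show ?thesis by simp
qed

text \<open>A discrete intermediate value argument: \<open>- ln\<close> of the orbit tends to
  infinity in steps of at most 1, so it comes within 1 of every level \<open>L\<close> above its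
  start, and \<open>wave\<close> has Lipschitz constant 2. The second conclusion forces late times
  for large \<open>L\<close>.\<close>

lemma wave_drift_near:
  assumes u: "0 < u" "u < 1" and L: "L \<ge> - ln u"
  obtains n where "\<bar>wave (- ln ((drift ^^ n) u)) - wave L\<bar> \<le> 2" "- ln ((drift ^^ n) u) \<ge> L - 1"
proof -
  define l where "l n = - ln ((drift ^^ n) u)" for n
  note b = drift_funpow_bounds[OF u]
  have "\<exists>n. l n > L"
  proof -
    have "eventually (\<lambda>n. (drift ^^ n) u < exp (- L)) sequentially"
      using drift_funpow_tendsto_0[OF u] by (rule order_tendstoD) simp
    then obtain n where "(drift ^^ n) u < exp (- L)"
      by (auto simp: eventually_sequentially)
    then have "ln ((drift ^^ n) u) < - L"
      using b[of n] by (metis ln_exp ln_less_cancel_iff exp_gt_zero)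
    then show ?thesis
      by (auto simp: l_def intro!: exI[of _ n])
  qed
  \<comment> \<open>The witness is the predecessor of the first time above \<open>L\<close>; it
    exists because the orbit starts at or below \<open>L\<close>.\<close>
  define m where "m = (LEAST n. l n > L)"
  have m: "l m > L"
    unfolding m_def by (rule LeastI_ex) fact
  have "m \<noteq> 0"
    using m L by (intro notI) (simp add: l_def)
  then obtain n where n: "m = Suc n"
    by (cases m) auto
  have "l n \<le> L"
    using not_less_Least[of n "\<lambda>n. l n > L"] n by (simp add: m_def not_less)
  moreover have "l (Suc n) - l n \<le> 1"
  proof -
    define v where "v = (drift ^^ n) u"
    have v: "0 < v" "v < 1"
      using b[of n] by (auto simp: v_def)
    have "l (Suc n) - l n = ln v - ln (drift v)"
      by (simp add: l_def v_def)
    also have "\<dots> \<le> v * (1 - v)"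
      by (rule ln_drift[OF v])
    also have "\<dots> \<le> 1"
      using v by (intro mult_le_one) auto
    finally show ?thesis .
  qed
  moreover have "L < l (Suc n)"
    using m n by simp
  ultimately have close: "\<bar>l n - L\<bar> \<le> 1"
    by linarith
  have "l n \<ge> 0" "L \<ge> 0"
    using b[of n] L u by (auto simp: l_def intro: order_trans[of _ "- ln u"])
  then have "\<bar>wave (l n) - wave L\<bar> \<le> 2"
    using wave_lipschitz[of "l n" L] close by force
  moreover have "l n \<ge> L - 1"
    using close by linarith
  ultimately show thesis
    using that[of n] by (simp add: l_def)
qed

lemma wave_peaks: "wave (exp (pi / 2 + 2 * pi * real n) - 1) = exp (pi / 2 + 2 * pi * real n)"
proof -
  have "sin (pi / 2 + 2 * pi * real n) = 1"
    using cos_2npi[of n] by (simp add: sin_add mult.commute mult.left_commute)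
  then show ?thesis
    by (simp add: wave_def)
qed

lemma wave_zeros: "wave (exp (2 * pi * real n) - 1) = 0"
  using sin_2npi[of n] by (simp add: wave_def mult.commute mult.left_commute)

section \<open>The quasiregular map\<close>

text \<open>The quadratic piece is chosen such that \<open>eta\<close> and its derivative are both at most \<open>1\<close> for \<open>y \<le> 0\<close>
  and both at least \<open>1\<close> for \<open>y \<ge> 0\<close>: the determinant of the derivative is at least
  \<open>(1 - eta) (1 - eta')\<close> for \<open>y \<ge> -2\<close>.\<close>

definition eta :: "real \<Rightarrow> real" where
  "eta y = (if y \<le> -2 then 0 else if y \<le> 0 then (1 + y / 2)\<^sup>2 else exp y)"

definition eta' :: "real \<Rightarrow> real" where
  "eta' y = (if y \<le> -2 then 0 else if y \<le> 0 then 1 + y / 2 else exp y)"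

definition shift :: "real \<Rightarrow> real" where
  "shift y = (if -3 < y \<and> y < -2 then slide (y + 3) else 0)"

definition shift' :: "real \<Rightarrow> real" where
  "shift' y = (if -3 < y \<and> y < -2 then slide' (y + 3) else 0)"

definition height :: "real \<Rightarrow> real" where
  "height y = (if -3 < y \<and> y < -2 then drift (y + 3) - 3 else y)"

definition height' :: "real \<Rightarrow> real" where
  "height' y = (if -3 < y \<and> y < -2 then 1 - (y + 3) + 3/2 * (y + 3)\<^sup>2 else 1)"

text \<open>With z = x + i y, exp (- i z) is e^y (cos x - i sin x); \<open>eta\<close> takes the
  place of e^y.\<close>

definition qrmap :: "plane \<Rightarrow> plane" where
  "qrmap v = vector [v $ 1 + eta (v $ 2) * cos (v $ 1) + shift (v $ 2),
                     height (v $ 2) - eta (v $ 2) * sin (v $ 1)]"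

definition qrmap' :: "plane \<Rightarrow> real^2^2" where
  "qrmap' v = vector
     [vector [1 - eta (v $ 2) * sin (v $ 1), eta' (v $ 2) * cos (v $ 1) + shift' (v $ 2)],
      vector [- eta (v $ 2) * cos (v $ 1), height' (v $ 2) - eta' (v $ 2) * sin (v $ 1)]]"

lemma continuous_eta: "continuous_on UNIV eta"
proof -
  have "eta = (\<lambda>y. (max 0 (1 + min y 0 / 2))\<^sup>2 * exp (max y 0))"
    by (auto simp: eta_def fun_eq_iff max_def min_def)
  moreover have "continuous_on UNIV \<dots>"
    by (auto intro!: continuous_intros)
  ultimately show ?thesis
    by (simp only:)
qed

lemma continuous_height: "continuous_on UNIV height"
proof -
  have "height = (\<lambda>y. y - (max 0 (min 1 (y + 3)))\<^sup>2 * (1 - max 0 (min 1 (y + 3))) / 2)"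
    by (auto simp: height_def drift_def fun_eq_iff max_def min_def)
  moreover have "continuous_on UNIV \<dots>"
    by (auto intro!: continuous_intros)
  ultimately show ?thesis
    by (simp only:)
qed

lemma has_real_derivative_transform_open:
  assumes "(g has_real_derivative d) (at y)" "a < y" "y < b" "\<And>z. a < z \<Longrightarrow> z < b \<Longrightarrow> g z = h z"
  shows "(h has_real_derivative d) (at y)"
  by (rule has_field_derivative_transform_within_open[OF assms(1), of "{a<..<b}"]) (use assms in auto)

lemma shift_has_derivative:
  assumes "y \<notin> {-3, -2}"
  shows "(shift has_real_derivative shift' y) (at y)"
proof -
  consider "y < -3" | "-3 < y" "y < -2" | "-2 < y"
    using assms by fastforce
  then show ?thesis
  proof cases
    case 1
    show ?thesis
      by (rule has_real_derivative_transform_open[of "\<lambda>_. 0" _ y "y - 1" "-3"]) (use 1 in \<open>auto simp: shift_def shift'_def\<close>)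
  next
    case 2
    have "((\<lambda>y. slide (y + 3)) has_real_derivative slide' (y + 3)) (at y)"
      using 2 by (intro DERIV_shift[THEN iffD1] slide_has_derivative) auto
    then have "((\<lambda>y. slide (y + 3)) has_real_derivative shift' y) (at y)"
      using 2 by (simp add: shift'_def)
    then show ?thesis
      by (rule has_real_derivative_transform_open[of "\<lambda>y. slide (y + 3)" _ y "-3" "-2"]) (use 2 in \<open>auto simp: shift_def shift'_def\<close>)
  next
    case 3
    show ?thesis
      by (rule has_real_derivative_transform_open[of "\<lambda>_. 0" _ y "-2" "y + 1"]) (use 3 in \<open>auto simp: shift_def shift'_def\<close>)
  qed
qed

lemma height_has_derivative:
  assumes "y \<notin> {-3, -2}"
  shows "(height has_real_derivative height' y) (at y)"
proof -
  consider "y < -3" | "-3 < y" "y < -2" | "-2 < y"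
    using assms by fastforce
  then show ?thesis
  proof cases
    case 1
    show ?thesis
      by (rule has_real_derivative_transform_open[of "\<lambda>z. z" _ y "y - 1" "-3"]) (use 1 in \<open>auto simp: height_def height'_def\<close>)
  next
    case 2
    have "((\<lambda>y. drift (y + 3) - 3) has_real_derivative 1 - (y + 3) + 3/2 * (y + 3)\<^sup>2) (at y)"
      using DERIV_diff[OF DERIV_shift[THEN iffD1, OF drift_has_derivative[of "y + 3"]] DERIV_const[of 3]]
      by simp
    then have "((\<lambda>y. drift (y + 3) - 3) has_real_derivative height' y) (at y)"
      using 2 by (simp add: height'_def)
    then show ?thesis
      by (rule has_real_derivative_transform_open[of "\<lambda>y. drift (y + 3) - 3" _ y "-3" "-2"]) (use 2 in \<open>auto simp: height_def height'_def\<close>)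
  next
    case 3
    show ?thesis
      by (rule has_real_derivative_transform_open[of "\<lambda>z. z" _ y "-2" "y + 1"]) (use 3 in \<open>auto simp: height_def height'_def\<close>)
  qed
qed

lemma eta_has_derivative:
  assumes "y \<notin> {-2, 0}"
  shows "(eta has_real_derivative eta' y) (at y)"
proof -
  consider "y < -2" | "-2 < y" "y < 0" | "0 < y"
    using assms by fastforce
  then show ?thesis
  proof cases
    case 1
    show ?thesis
      by (rule has_real_derivative_transform_open[of "\<lambda>_. 0" _ y "y - 1" "-2"]) (use 1 in \<open>auto simp: eta_def eta'_def\<close>)
  next
    case 2
    have "((\<lambda>y. (1 + y / 2)\<^sup>2) has_real_derivative 1 + y / 2) (at y)"
      by (auto intro!: derivative_eq_intros)
    then have "((\<lambda>y. (1 + y / 2)\<^sup>2) has_real_derivative eta' y) (at y)"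
      using 2 by (simp add: eta'_def)
    then show ?thesis
      by (rule has_real_derivative_transform_open[of "\<lambda>y. (1 + y / 2)\<^sup>2" _ y "-2" "0"]) (use 2 in \<open>auto simp: eta_def eta'_def\<close>)
  next
    case 3
    show ?thesis
      by (rule has_real_derivative_transform_open[of exp _ y "0" "y + 1"]) (use 3 in \<open>auto simp: eta_def eta'_def\<close>)
  qed
qed

lemma abs_shift_le: "\<bar>shift y\<bar> \<le> 2 * \<bar>(y + 3) * (y + 2)\<bar>"
proof (cases "-3 < y \<and> y < -2")
  case True
  then have "(y + 3) * (y + 2) \<le> 0"
    by (intro mult_nonneg_nonpos) auto
  then have "(y + 3) * (1 - (y + 3)) = \<bar>(y + 3) * (y + 2)\<bar>"
    by (simp add: abs_of_nonpos algebra_simps)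
  then show ?thesis
    using abs_slide_le[of "y + 3"] True by (simp add: shift_def)
qed (auto simp: shift_def)

lemma continuous_shift: "continuous_on UNIV shift"
proof (rule continuous_at_imp_continuous_on, rule ballI)
  fix y :: real
  show "isCont shift y"
  proof (cases "y \<in> {-3, -2}")
    case True
    have "((\<lambda>z. 2 * \<bar>(z + 3) * (z + 2)\<bar>) \<longlongrightarrow> 2 * \<bar>(y + 3) * (y + 2)\<bar>) (at y)"
      by (intro tendsto_intros)
    moreover have "2 * \<bar>(y + 3) * (y + 2)\<bar> = 0"
      using True by auto
    ultimately have "((\<lambda>z. 2 * \<bar>(z + 3) * (z + 2)\<bar>) \<longlongrightarrow> 0) (at y)"
      by metis
    then have "(shift \<longlongrightarrow> 0) (at y)"
      by (rule Lim_null_comparison[rotated]) (use abs_shift_le in auto)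
    then show ?thesis
      using True by (auto simp: isCont_def shift_def)
  qed (use shift_has_derivative DERIV_isCont in blast)
qed

lemma borel_measurable_qrmap':
  "(\<lambda>v. qrmap' v $ i $ j) \<in> borel_measurable borel"
proof -
  have [measurable]: "eta \<in> borel_measurable borel" "sin \<in> borel_measurable (borel :: real measure)"
     "cos \<in> borel_measurable (borel :: real measure)"
    by (auto intro!: borel_measurable_continuous_onI continuous_eta continuous_intros)
  have [measurable]: "eta' \<in> borel_measurable borel" "height' \<in> borel_measurable borel"
    unfolding eta'_def[abs_def] height'_def[abs_def] by measurable
  have [measurable]: "shift' \<in> borel_measurable borel"
    unfolding shift'_def[abs_def] slide'_def[abs_def] wave'_def[abs_def] drift_def[abs_def] by measurable
  show ?thesis
    using exhaust_2[of i] exhaust_2[of j] unfolding qrmap'_def by (auto simp: vector_2)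
qed

lemma eta_bounds: "\<bar>eta y\<bar> \<le> exp \<bar>y\<bar>" "\<bar>eta' y\<bar> \<le> exp \<bar>y\<bar>"
proof -
  have 1: "1 \<le> exp \<bar>y\<bar>" by simp
  have 2: "(1 + y / 2)\<^sup>2 \<le> 1" if "-2 \<le> y" "y \<le> 0"
    using that power_mono[of "1 + y / 2" 1 2] by auto
  show "\<bar>eta y\<bar> \<le> exp \<bar>y\<bar>"
    unfolding eta_def using 1 2 by (auto intro: order_trans)
  show "\<bar>eta' y\<bar> \<le> exp \<bar>y\<bar>"
    unfolding eta'_def using 1 by (auto intro: order_trans[of _ 1])
qed

lemma abs_shift'_le: "\<bar>shift' y\<bar> \<le> 4"
  using abs_slide'_le[of "y + 3"] by (auto simp: shift'_def)

lemma height'_bounds: "5/6 \<le> height' y" "height' y \<le> 3/2"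
  using drift_derivative_bounds[of "y + 3"] by (auto simp: height'_def)

lemma qrmap'_locally_bounded: "\<exists>B. \<forall>v. norm v \<le> R \<longrightarrow> \<bar>qrmap' v $ i $ j\<bar> \<le> B"
proof (intro exI allI impI)
  fix v :: plane assume v: "norm v \<le> R"
  have "\<bar>v $ 2\<bar> \<le> R"
    using component_le_norm_cart[of v 2] v by linarith
  then have e: "\<bar>eta (v $ 2)\<bar> \<le> exp R" "\<bar>eta' (v $ 2)\<bar> \<le> exp R"
    using eta_bounds[of "v $ 2"] by (auto intro: order_trans)
  have m: "\<bar>a * b\<bar> \<le> exp R" if "\<bar>a\<bar> \<le> exp R" "\<bar>b\<bar> \<le> 1" for a b :: real
    using mult_mono[OF that] by (simp add: abs_mult)
  have "\<bar>eta (v $ 2) * sin (v $ 1)\<bar> \<le> exp R" "\<bar>eta' (v $ 2) * cos (v $ 1)\<bar> \<le> exp R"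
     "\<bar>eta (v $ 2) * cos (v $ 1)\<bar> \<le> exp R" "\<bar>eta' (v $ 2) * sin (v $ 1)\<bar> \<le> exp R"
    using e by (auto intro!: m)
  then show "\<bar>qrmap' v $ i $ j\<bar> \<le> exp R + 4"
    using exhaust_2[of i] exhaust_2[of j] abs_shift'_le[of "v $ 2"] height'_bounds[of "v $ 2"]
    by (auto simp: qrmap'_def vector_2 abs_le_iff)
qed

lemma continuous_qrmap: "continuous_on UNIV qrmap"
proof -
  have "continuous_on UNIV (\<lambda>v. qrmap v $ i)" for i
  proof -
    have c: "continuous_on UNIV (\<lambda>v::plane. h (v $ 2))" if "continuous_on UNIV h" for h :: "real \<Rightarrow> real"
      by (rule continuous_on_compose2[OF that]) (auto intro!: continuous_intros)
    have "continuous_on UNIV (\<lambda>v::plane. v $ 1 + eta (v $ 2) * cos (v $ 1) + shift (v $ 2))"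
      "continuous_on UNIV (\<lambda>v::plane. height (v $ 2) - eta (v $ 2) * sin (v $ 1))"
      by (intro continuous_intros c continuous_eta continuous_height continuous_shift)+
    then show ?thesis
      using exhaust_2[of i] by (auto simp: qrmap_def vector_2)
  qed
  then have "continuous_on UNIV (\<lambda>v. \<chi> i. qrmap v $ i)"
    by (intro continuous_on_vec_lambda)
  then show ?thesis
    by simp
qed

lemma qrmap_has_partial:
  assumes "v $ 2 \<notin> {-3, -2, 0}"
  shows "((\<lambda>t. qrmap (v + t *\<^sub>R axis j 1) $ i) has_real_derivative qrmap' v $ i $ j) (at 0)"
proof -
  have eta: "((\<lambda>t. eta (v $ 2 + t)) has_real_derivative eta' (v $ 2)) (at 0)"
    and shift: "((\<lambda>t. shift (v $ 2 + t)) has_real_derivative shift' (v $ 2)) (at 0)"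
    and height: "((\<lambda>t. height (v $ 2 + t)) has_real_derivative height' (v $ 2)) (at 0)"
    using assms eta_has_derivative[of "v $ 2"] shift_has_derivative[of "v $ 2"] height_has_derivative[of "v $ 2"]
      DERIV_shift[of eta "eta' (v $ 2)" 0 "v $ 2"] DERIV_shift[of shift "shift' (v $ 2)" 0 "v $ 2"]
      DERIV_shift[of height "height' (v $ 2)" 0 "v $ 2"]
    by (auto simp: add.commute)
  show ?thesis
    using exhaust_2[of i] exhaust_2[of j] eta shift height
    by (auto simp: qrmap_def qrmap'_def vector_2 axis_def intro!: derivative_eq_intros)
qed

lemma W12_loc_deriv_qrmap: "W12_loc_deriv qrmap qrmap'"
  unfolding W12_loc_deriv_def
proof (intro conjI allI)
  fix i j :: 2
  have c: "continuous_on UNIV (\<lambda>v. qrmap v $ i)"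
    using continuous_qrmap by (intro continuous_intros)
  show "L2_loc (\<lambda>v. qrmap v $ i)"
  proof (rule L2_loc_locally_bounded)
    show "\<exists>B. \<forall>x. norm x \<le> R \<longrightarrow> \<bar>qrmap x $ i\<bar> \<le> B" for R
      using continuous_bounded_on_cball[OF c] by metis
  qed (rule borel_measurable_continuous_onI[OF c])
  show "L2_loc (\<lambda>v. qrmap' v $ i $ j)"
    by (rule L2_loc_locally_bounded[OF borel_measurable_qrmap' qrmap'_locally_bounded])
  show "has_weak_partial j (\<lambda>v. qrmap v $ i) (\<lambda>v. qrmap' v $ i $ j)"
    by (rule has_weak_partial_piecewise[where E = "{-3, -2, 0}",
          OF c borel_measurable_qrmap' qrmap'_locally_bounded _ qrmap_has_partial]) auto
qed

lemma onorm_2x2_le: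
  fixes D :: "real^2^2"
  shows "(onorm (\<lambda>v. D *v v))\<^sup>2 \<le> (D$1$1)\<^sup>2 + (D$1$2)\<^sup>2 + (D$2$1)\<^sup>2 + (D$2$2)\<^sup>2"
proof -
  define c where "c = (D$1$1)\<^sup>2 + (D$1$2)\<^sup>2 + (D$2$1)\<^sup>2 + (D$2$2)\<^sup>2"
  have c: "c \<ge> 0"
    by (simp add: c_def)
  have "norm (D *v v) \<le> sqrt c * norm v" for v
  proof -
    \<comment> \<open>Cauchy-Schwarz for both rows at once, by Lagrange's identity.\<close>
    have "(D$1$1 * v$1 + D$1$2 * v$2)\<^sup>2 + (D$2$1 * v$1 + D$2$2 * v$2)\<^sup>2
       + ((D$1$1 * v$2 - D$1$2 * v$1)\<^sup>2 + (D$2$1 * v$2 - D$2$2 * v$1)\<^sup>2) = c * ((v$1)\<^sup>2 + (v$2)\<^sup>2)"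
      by (simp add: c_def power2_eq_square algebra_simps)
    then have "(D$1$1 * v$1 + D$1$2 * v$2)\<^sup>2 + (D$2$1 * v$1 + D$2$2 * v$2)\<^sup>2 \<le> c * ((v$1)\<^sup>2 + (v$2)\<^sup>2)"
      by (smt (verit) zero_le_power2)
    then show ?thesis
      by (simp add: norm_vec_def L2_set_def sum_2 matrix_vector_mult_def flip: real_sqrt_mult)
  qed
  then have "onorm (\<lambda>v. D *v v) \<le> sqrt c"
    using c by (intro onorm_le) auto
  then have "(onorm (\<lambda>v. D *v v))\<^sup>2 \<le> (sqrt c)\<^sup>2"
    by (intro power_mono onorm_pos_le) auto
  then show ?thesis
    using c by (simp add: c_def)
qed

text \<open>The constant 24 is dictated by the strip, where the matrix is triangular with diagonal
  1, \<open>h\<close> and shear \<open>a\<close>: 1 + 16 + 9/4 is at most 24 * 5/6. For y > 0 the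
  map is holomorphic and 2 would do; in between, 3 would do.\<close>

lemma qrmap'_distortion:
  "(qrmap' v$1$1)\<^sup>2 + (qrmap' v$1$2)\<^sup>2 + (qrmap' v$2$1)\<^sup>2 + (qrmap' v$2$2)\<^sup>2 \<le> 24 * det (qrmap' v)"
proof -
  define s c where "s = sin (v $ 1)" and "c = cos (v $ 1)"
  have sc: "c\<^sup>2 = 1 - s\<^sup>2" "s \<le> 1"
    by (auto simp: s_def c_def cos_squared_eq)
  consider "v $ 2 \<le> -2" | "-2 < v $ 2" "v $ 2 \<le> 0" | "0 < v $ 2"
    by fastforce
  then show ?thesis
  proof cases
    case 1
    define a h where "a = shift' (v $ 2)" and "h = height' (v $ 2)"
    have "a\<^sup>2 \<le> 4\<^sup>2"
      using abs_shift'_le[of "v $ 2"] power_mono[of "\<bar>a\<bar>" 4 2] by (simp add: a_def)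
    moreover have "5/6 \<le> h" "h \<le> 3/2"
      using height'_bounds by (auto simp: h_def)
    moreover from this have "h\<^sup>2 \<le> (3/2)\<^sup>2"
      by (intro power_mono) auto
    ultimately have "1 + a\<^sup>2 + h\<^sup>2 \<le> 24 * h"
      by (simp add: power2_eq_square)
    then show ?thesis
      using 1 by (simp add: qrmap'_def vector_2 det_2 eta_def eta'_def a_def h_def)
  next
    case 2
    define t where "t = 1 + v $ 2 / 2"
    have t: "0 \<le> t" "t \<le> 1"
      using 2 by (auto simp: t_def)
    have "det (qrmap' v) = (1 - t\<^sup>2 * s) * (1 - t * s) + t^3 * c\<^sup>2"
      using 2 by (simp add: qrmap'_def vector_2 det_2 eta_def eta'_def shift'_def height'_def t_def s_def c_def
          power2_eq_square power3_eq_cube algebra_simps)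
    also have "\<dots> = 1 - (t + t\<^sup>2) * s + t^3"
      unfolding sc(1) by (simp add: power2_eq_square power3_eq_cube algebra_simps)
    finally have d: "det (qrmap' v) = 1 - (t + t\<^sup>2) * s + t^3" .
    \<comment> \<open>The determinant is smallest at \<open>s = 1\<close>, where it factors as (1 -
      t) (1 - t^2).\<close>
    have "(1 - t)\<^sup>2 \<le> (1 - t)\<^sup>2 * (1 + t)"
      using t mult_left_mono[of 1 "1 + t" "(1 - t)\<^sup>2"] by simp
    also have "\<dots> = 1 - (t + t\<^sup>2) * 1 + t^3"
      by (simp add: power2_eq_square power3_eq_cube algebra_simps)
    also have "\<dots> \<le> 1 - (t + t\<^sup>2) * s + t^3"
      using mult_left_mono[OF sc(2), of "t + t\<^sup>2"] t by simp
    finally have d2: "(1 - t)\<^sup>2 \<le> det (qrmap' v)"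
      using d by simp
    have "(qrmap' v$1$1)\<^sup>2 + (qrmap' v$1$2)\<^sup>2 + (qrmap' v$2$1)\<^sup>2 + (qrmap' v$2$2)\<^sup>2
        = (1 - t\<^sup>2 * s)\<^sup>2 + t\<^sup>2 * c\<^sup>2 + t^4 * c\<^sup>2 + (1 - t * s)\<^sup>2"
      using 2 by (simp add: qrmap'_def vector_2 eta_def eta'_def shift'_def height'_def t_def s_def c_def
          power_mult_distrib)
    \<comment> \<open>The excess of the sum of squares over twice the determinant measures the
      failure of the Cauchy-Riemann equations; here it is \<open>(eta - eta')\<^sup>2\<close>. It
      tends to 0 with the determinant as \<open>t\<close> approaches 1, which keeps the quotient
      bounded.\<close>
    also have "\<dots> = 2 * (1 - (t + t\<^sup>2) * s + t^3) + t\<^sup>2 * (1 - t)\<^sup>2"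
      unfolding sc(1) by (simp add: power2_eq_square power3_eq_cube power4_eq_xxxx algebra_simps)
    also have "\<dots> \<le> 2 * (1 - (t + t\<^sup>2) * s + t^3) + 1 * (1 - t)\<^sup>2"
      using t by (intro add_left_mono mult_right_mono) (auto simp: power_le_one)
    finally show ?thesis
      unfolding d[symmetric] using d2 zero_le_power2[of "1 - t"] by linarith
  next
    case 3
    define t where "t = exp (v $ 2)"
    have "det (qrmap' v) = (1 - t * s)\<^sup>2 + t\<^sup>2 * c\<^sup>2"
      using 3 by (simp add: qrmap'_def vector_2 det_2 eta_def eta'_def shift'_def height'_def t_def s_def c_def
          power2_eq_square algebra_simps)
    moreover have "(qrmap' v$1$1)\<^sup>2 + (qrmap' v$1$2)\<^sup>2 + (qrmap' v$2$1)\<^sup>2 + (qrmap' v$2$2)\<^sup>2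
        = 2 * ((1 - t * s)\<^sup>2 + t\<^sup>2 * c\<^sup>2)"
      using 3 by (simp add: qrmap'_def vector_2 eta_def eta'_def shift'_def height'_def t_def s_def c_def
          power_mult_distrib)
    moreover have "0 \<le> (1 - t * s)\<^sup>2 + t\<^sup>2 * c\<^sup>2"
      by simp
    moreover have "2 * p \<le> 24 * p" if "0 \<le> p" for p :: real
      using that by linarith
    ultimately show ?thesis
      by metis
  qed
qed

lemma quasiregular_qrmap: "quasiregular qrmap"
  unfolding quasiregular_def
proof (intro conjI exI[of _ qrmap'] exI[of _ 24])
  show "AE v in lebesgue. (onorm ((*v) (qrmap' v)))\<^sup>2 \<le> 24 * det (qrmap' v)"
    using onorm_2x2_le qrmap'_distortion by (intro AE_I2) (blast intro: order_trans)
qed (auto simp: continuous_qrmap W12_loc_deriv_qrmap)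

section \<open>Dynamics\<close>

definition of_cplx :: "complex \<Rightarrow> plane" where
  "of_cplx z = vector [Re z, Im z]"

lemma of_cplx_nth [simp]: "of_cplx z $ 1 = Re z" "of_cplx z $ 2 = Im z"
  by (simp_all add: of_cplx_def)

lemma of_cplx_Complex [simp]: "of_cplx (Complex (v $ 1) (v $ 2)) = v"
  by (simp add: vec_eq_iff forall_2)

lemma of_cplx_eq_iff [simp]: "of_cplx z = of_cplx w \<longleftrightarrow> z = w"
  by (auto simp: vec_eq_iff forall_2 complex_eq_iff)

lemma norm_of_cplx [simp]: "norm (of_cplx z) = norm z"
  by (simp add: norm_vec_def L2_set_def sum_2 cmod_def)

lemma dist_of_cplx [simp]: "dist (of_cplx z) (of_cplx w) = dist z w"
proof -
  have "of_cplx z - of_cplx w = of_cplx (z - w)"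
    by (simp add: vec_eq_iff forall_2)
  then show ?thesis
    by (simp add: dist_norm)
qed

lemma qrmap_of_cplx: "Im z \<ge> 0 \<Longrightarrow> qrmap (of_cplx z) = of_cplx (expmap z)"
  by (cases "Im z = 0")
     (auto simp: qrmap_def expmap_def vec_eq_iff forall_2 eta_def shift_def height_def Re_exp Im_exp)

section \<open>Iterates of a small disc on the vertical line cover the plane\<close>

definition ray :: "real \<Rightarrow> nat \<Rightarrow> real" where
  "ray y k = ((\<lambda>t. t + exp t) ^^ k) y"

lemma ray_Suc: "ray y (Suc k) = ray y k + exp (ray y k)"
  by (simp add: ray_def)

lemma ray_ge:
  assumes "y \<ge> 0"
  shows "ray y k \<ge> y + real k"
proof (induction k)
  case (Suc k)
  then have "exp (ray y k) \<ge> 1"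
    using assms by simp
  with Suc show ?case
    unfolding ray_Suc of_nat_Suc by linarith
qed (simp add: ray_def)

text \<open>The old radius is limited to 1/4 by the inversion lemma, but the new one is not. The
  same step therefore serves both for the gradual growth up to 1/4 and for the final jump to radius
  8. Large \<open>Y\<close> keeps the old disc in the upper half-plane, where the map is
  \<open>expmap\<close>.\<close>

lemma qrmap_funpow_covers_step:
  assumes U: "\<And>w. w \<in> cball (Complex (- pi/2) Y) r \<Longrightarrow> \<exists>v\<in>U. (qrmap ^^ k) v = of_cplx w"
    and Y: "Y \<ge> 1" and r: "0 \<le> r" "r \<le> 1/4"
    and w: "w \<in> cball (Complex (- pi/2) (Y + exp Y)) (r * exp Y / 2)"
  shows "\<exists>v\<in>U. (qrmap ^^ Suc k) v = of_cplx w"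
proof -
  have "w \<in> cball (expmap (Complex (- pi/2) Y)) (r * exp Y / 2)"
    using w by (simp only: expmap_ray)
  then obtain z where z: "z \<in> cball (Complex (- pi/2) Y) r" "expmap z = w"
    using expmap_expanding_near_ray[of Y r w] Y r by auto
  have "\<bar>Im z - Y\<bar> \<le> r"
    using z(1) abs_Im_le_cmod[of "z - Complex (- pi/2) Y"] by (simp add: dist_norm norm_minus_commute)
  then have "Im z \<ge> 0"
    using Y r by linarith
  moreover obtain v where "v \<in> U" "(qrmap ^^ k) v = of_cplx z"
    using U[OF z(1)] by auto
  ultimately show ?thesis
    using z(2) qrmap_of_cplx[of z] by (intro bexI[of _ v]) simp_all
qed

text \<open>Above height 3 the expansion factor exp Y / 2 is at least 2, so the radius doubles until
  it reaches the cap 1/4.\<close>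

lemma qrmap_funpow_covers_ball:
  assumes y: "y \<ge> 3" and r: "0 < r"
    and U: "\<And>z. z \<in> cball (Complex (- pi/2) y) r \<Longrightarrow> of_cplx z \<in> U"
    and w: "w \<in> cball (Complex (- pi/2) (ray y k)) (min (2 ^ k * r) (1/4))"
  shows "\<exists>v\<in>U. (qrmap ^^ k) v = of_cplx w"
  using w
proof (induction k arbitrary: w)
  case 0
  then show ?case
    using U by (intro bexI[of _ "of_cplx w"]) (auto simp: ray_def)
next
  case (Suc k)
  define s where "s = min (2 ^ k * r) (1/4)"
  have s: "0 \<le> s" "s \<le> 1/4"
    using r by (auto simp: s_def)
  have Y: "ray y k \<ge> 3"
    using ray_ge[of y k] y by linarith
  have "exp (ray y k) \<ge> 4"
    using exp_ge_add_one_self[of "ray y k"] Y by linarith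
  then have "s * 4 / 2 \<le> s * exp (ray y k) / 2"
    using s by (intro divide_right_mono mult_left_mono) auto
  moreover have "min (2 ^ Suc k * r) (1/4) \<le> s * 4 / 2"
    unfolding s_def by (auto simp: min_def)
  ultimately have "w \<in> cball (Complex (- pi/2) (ray y k + exp (ray y k))) (s * exp (ray y k) / 2)"
    using Suc.prems unfolding ray_Suc by (simp only: mem_cball)
  then show ?case
    using Suc.IH Y s by (intro qrmap_funpow_covers_step[where Y = "ray y k" and r = s]) (auto simp: s_def)
qed

lemma qrmap_funpow_covers_plane:
  assumes y: "y \<ge> 3" and U: "open U" "of_cplx (Complex (- pi/2) y) \<in> U"
  shows "(\<Union>k\<in>{1..}. (qrmap ^^ k) ` U) = UNIV"
proof -
  obtain r where r: "r > 0" "cball (of_cplx (Complex (- pi/2) y)) r \<subseteq> U"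
    using U open_contains_cball by metis
  have Ur: "of_cplx z \<in> U" if "z \<in> cball (Complex (- pi/2) y) r" for z
    using r that by (auto simp: subset_iff)
  have "\<exists>k\<ge>1. v \<in> (qrmap ^^ k) ` U" for v
  proof -
    define w where "w = Complex (v $ 1) (v $ 2)"
    have v: "v = of_cplx w"
      by (simp add: w_def)
    obtain m where m: "1 / (4 * r) < 2 ^ m"
      using real_arch_pow[of 2 "1 / (4 * r)"] by auto
    obtain l :: nat where l: "norm w + 200 < real l"
      using reals_Archimedean2 by blast
    define k where "k = m + l"
    have "2 ^ m * r \<le> 2 ^ k * r"
      using r unfolding k_def by (intro mult_right_mono power_increasing) auto
    moreover have "1/4 < 2 ^ m * r"
      using m r by (simp add: field_simps)
    ultimately have kr: "min (2 ^ k * r) (1/4) = 1/4"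
      by linarith
    define Y where "Y = ray y (Suc k)"
    have big: "ray y k \<ge> norm w + 200" "Y \<ge> norm w + 200"
      using ray_ge[of y k] ray_ge[of y "Suc k"] l y by (auto simp: k_def Y_def)
    have cover: "\<exists>v\<in>U. (qrmap ^^ Suc k) v = of_cplx z" if "z \<in> cball (Complex (- pi/2) Y) 8" for z
    proof (rule qrmap_funpow_covers_step[where Y = "ray y k" and r = "1/4"])
      show "\<exists>v\<in>U. (qrmap ^^ k) v = of_cplx z'" if "z' \<in> cball (Complex (- pi / 2) (ray y k)) (1/4)" for z'
        using qrmap_funpow_covers_ball[OF y r(1) Ur, of z' k] that kr by simp
      show "ray y k \<ge> 1"
        using big norm_ge_zero[of w] by linarith
      \<comment> \<open>64 is what carries radius 1/4 to radius 8.\<close>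
      have "exp (ray y k) \<ge> 64"
        using exp_ge_add_one_self[of "ray y k"] big norm_ge_zero[of w] by linarith
      then have "8 \<le> 1/4 * exp (ray y k) / 2"
        by simp
      then show "z \<in> cball (Complex (- pi / 2) (ray y k + exp (ray y k))) (1/4 * exp (ray y k) / 2)"
        using that unfolding Y_def ray_Suc by (simp only: mem_cball)
    qed auto
    \<comment> \<open>Inner radius of the annulus covered by the disc of radius 8 around height
      \<open>Y\<close>. The integer \<open>n\<close> is chosen so that the left preimage
      \<open>z\<close> of \<open>w\<close> satisfies \<open>a \<le> norm z \<le> 16 * a\<close>;
      since 16 is at most e^4, \<open>z\<close> lies in this annulus.\<close>
    define a where "a = exp (Y - 2)"
    have a: "a \<ge> norm w + 199"
      unfolding a_def using exp_ge_add_one_self[of "Y - 2"] big by linarith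
    define n where "n = nat \<lceil>a\<rceil>"
    have n: "a \<le> real n" "real n \<le> a + 1"
      using of_int_ceiling_le_add_one[of a] le_of_int_ceiling[of a]
      by (simp_all add: n_def a_def)
    have wn: "real n \<ge> norm w + 4"
      using n a by linarith
    obtain z where z: "expmap z = w" "Im z \<ge> 0" "norm z \<ge> real n" "norm z \<le> 13 * real n + 4 + norm w"
      using expmap_preimage_left[OF wn] by metis
    have nz: "a \<le> norm z" "norm z \<le> 16 * a"
      using z n a norm_ge_zero[of w] by linarith+
    have "exp (4::real) \<ge> 16"
    proof -
      have "exp (4::real) = exp 1 ^ 4"
        by (simp flip: exp_of_nat_mult)
      also have "\<dots> \<ge> 2 ^ 4"
        using exp_ge_add_one_self[of 1] by (intro power_mono) auto
      finally show ?thesis by simp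
    qed
    then have "16 * a \<le> exp 4 * a"
      by (intro mult_right_mono) (auto simp: a_def)
    also have "exp 4 * a = exp (Y + 2)"
      by (simp add: a_def flip: exp_add)
    finally have nz2: "norm z \<le> exp (Y + 2)"
      using nz by linarith
    have "norm z > 0"
      using nz a norm_ge_zero[of w] by linarith
    then have "ln (norm z) \<le> ln (exp (Y + 2))" "ln (exp (Y - 2)) \<le> ln (norm z)"
      using nz2 nz(1) unfolding a_def by (subst ln_le_cancel_iff; simp)+
    then have "ln (norm z) \<le> Y + 2" "ln (norm z) \<ge> Y - 2"
      by simp_all
    moreover have "norm z \<ge> 100"
      using nz a norm_ge_zero[of w] by linarith
    ultimately obtain z' where z': "expmap z' = z" "Im z' \<ge> 0" "z' \<in> cball (Complex (- pi/2) Y) 8"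
      using expmap_preimage_annulus[of z Y] by (auto simp: abs_le_iff)
    obtain u where "u \<in> U" "(qrmap ^^ Suc k) u = of_cplx z'"
      using cover[OF z'(3)] by auto
    then have "(qrmap ^^ Suc (Suc (Suc k))) u = v"
      using z z' v by (simp add: qrmap_of_cplx)
    with \<open>u \<in> U\<close> show ?thesis
      by (intro exI[of _ "Suc (Suc (Suc k))"]) auto
  qed
  then show ?thesis
    by (fastforce simp: set_eq_iff)
qed

lemma zero_capacity_empty: "zero_capacity {}"
  by (simp add: zero_capacity_def compact_zero_capacity_def)

lemma segment_subset_julia_set: "vertical_segment (- pi/2) 3 4 \<subseteq> julia_set qrmap"
proof
  fix v assume v: "v \<in> vertical_segment (- pi/2) 3 4"
  then have eq: "v = of_cplx (Complex (- pi/2) (v $ 2))" and y: "v $ 2 \<ge> 3"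
    by (auto simp: vertical_segment_def vec_eq_iff forall_2)
  show "v \<in> julia_set qrmap"
    unfolding julia_set_def
  proof safe
    fix U assume "open U" "v \<in> U"
    then have "(\<Union>k\<in>{1..}. (qrmap ^^ k) ` U) = UNIV"
      using qrmap_funpow_covers_plane[OF y] eq by simp
    then show "zero_capacity (UNIV - (\<Union>k\<in>{1..}. (qrmap ^^ k) ` U))"
      by (simp add: zero_capacity_empty)
  qed
qed

section \<open>Essential singularity at infinity\<close>

text \<open>The left preimages exist for all large \<open>n\<close> and have norm at least
  \<open>n\<close>. A finite limit at infinity would thus equal every point of the plane, and the
  value 0 rules out an infinite limit.\<close>

lemma qrmap_frequently_eq: "\<exists>v. norm v \<ge> b \<and> qrmap v = of_cplx w"
proof -
  obtain n :: nat where n: "max b (norm w + 4) < real n"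
    using reals_Archimedean2 by blast
  then obtain z where "expmap z = w" "Im z \<ge> 0" "norm z \<ge> real n"
    using expmap_preimage_left[of w n] by auto
  then show ?thesis
    using n by (intro exI[of _ "of_cplx z"]) (auto simp: qrmap_of_cplx)
qed

lemma transcendental_type_qrmap: "transcendental_type qrmap"
  unfolding transcendental_type_def
proof (intro conjI notI)
  assume "\<exists>l. (qrmap \<longlongrightarrow> l) at_infinity"
  then obtain l where l: "(qrmap \<longlongrightarrow> l) at_infinity" ..
  have "l = of_cplx w" for w
  proof (rule ccontr)
    assume "l \<noteq> of_cplx w"
    then have "eventually (\<lambda>v. dist (qrmap v) l < dist (of_cplx w) l) at_infinity"
      using tendstoD[OF l, of "dist (of_cplx w) l"] by auto
    then obtain b where "\<And>v. norm v \<ge> b \<Longrightarrow> dist (qrmap v) l < dist (of_cplx w) l"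
      by (auto simp: eventually_at_infinity)
    then show False
      using qrmap_frequently_eq[of b w] by force
  qed
  then have "of_cplx 0 = of_cplx 1"
    by metis
  then show False by simp
next
  assume "filterlim qrmap at_infinity at_infinity"
  then have "eventually (\<lambda>v. norm (qrmap v) \<ge> 1) at_infinity"
    by (simp add: filterlim_at_infinity[of 0])
  then obtain b where "\<And>v. norm v \<ge> b \<Longrightarrow> norm (qrmap v) \<ge> 1"
    by (auto simp: eventually_at_infinity)
  then show False
    using qrmap_frequently_eq[of b 0] by force
qed

section \<open>Orbits in the strip and the boundary of the bungee set\<close>

text \<open>In the strip \<open>eta\<close> vanishes, so the heights evolve by \<open>drift\<close>
  alone and the displacements telescope. Only the values of \<open>wave\<close> along
  \<open>- ln\<close> of a \<open>drift\<close> orbit remain to be studied.\<close>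

lemma qrmap_funpow_strip:
  assumes "0 < u" "u < 1"
  shows "(qrmap ^^ n) (vector [a, u - 3])
    = vector [a + wave (- ln ((drift ^^ n) u)) - wave (- ln u), (drift ^^ n) u - 3]"
proof (induction n)
  case (Suc n)
  define t where "t = (drift ^^ n) u"
  have "0 < t" "t < 1"
    using drift_funpow_bounds[OF assms, of n] by (auto simp: t_def)
  then have "qrmap (vector [b, t - 3]) = vector [b + slide t, drift t - 3]" for b
    by (simp add: qrmap_def eta_def shift_def height_def vector_2)
  moreover have "(qrmap ^^ Suc n) (vector [a, u - 3])
      = qrmap (vector [a + wave (- ln t) - wave (- ln u), t - 3])"
    using Suc by (simp add: t_def)
  moreover have "(drift ^^ Suc n) u = drift t"
    by (simp add: t_def)
  ultimately show ?case
    by (simp only: slide_def) (simp add: algebra_simps)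
qed simp

lemma exp_level_ge: "exp (c + 2 * pi * real m) \<ge> real m" if "c \<ge> 0"
proof -
  have "1 * real m \<le> 2 * pi * real m"
    using pi_gt3 by (intro mult_right_mono) auto
  then show ?thesis
    using exp_ge_add_one_self[of "c + 2 * pi * real m"] that by linarith
qed

text \<open>Passing near high peaks of \<open>wave\<close> makes the orbit unbounded; passing near
  its zeros, at arbitrarily late times, brings the orbit back to a fixed bounded set.\<close>

lemma strip_subset_bungee_set:
  assumes u: "0 < u" "u < 1"
  shows "vector [a, u - 3] \<in> bungee_set qrmap"
proof -
  define x where "x n = a + wave (- ln ((drift ^^ n) u)) - wave (- ln u)" for n
  define c where "c = \<bar>a - wave (- ln u)\<bar>"
  have orb: "(qrmap ^^ n) (vector [a, u - 3]) = vector [x n, (drift ^^ n) u - 3]" for n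
    by (simp add: x_def qrmap_funpow_strip[OF u])
  have "\<not> bounded (range (\<lambda>n. (qrmap ^^ n) (vector [a, u - 3])))"
  proof
    assume "bounded (range (\<lambda>n. (qrmap ^^ n) (vector [a, u - 3])))"
    then obtain B where B: "\<And>n. norm (vector [x n, (drift ^^ n) u - 3] :: plane) \<le> B"
      by (auto simp: bounded_iff orb)
    have xB: "\<bar>x n\<bar> \<le> B" for n
      using component_le_norm_cart[of "vector [x n, (drift ^^ n) u - 3] :: plane" 1] B[of n] by simp
    obtain m :: nat where m: "\<bar>B\<bar> + c + \<bar>ln u\<bar> + 3 < real m"
      using reals_Archimedean2 by blast
    define P where "P = exp (pi / 2 + 2 * pi * real m)"
    have P: "P \<ge> real m"
      unfolding P_def by (rule exp_level_ge) simp
    then obtain n where "\<bar>wave (- ln ((drift ^^ n) u)) - wave (P - 1)\<bar> \<le> 2"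
      using wave_drift_near[OF u, of "P - 1"] m c_def by (smt (verit))
    moreover have "wave (P - 1) = P"
      unfolding P_def by (rule wave_peaks)
    ultimately show False
      using xB[of n] P m unfolding x_def c_def by linarith
  qed
  moreover have "\<not> filterlim (\<lambda>n. (qrmap ^^ n) (vector [a, u - 3])) at_infinity sequentially"
  proof
    assume "filterlim (\<lambda>n. (qrmap ^^ n) (vector [a, u - 3])) at_infinity sequentially"
    \<comment> \<open>At a zero of \<open>wave\<close> the abscissa is at most \<open>c + 2\<close>
      and the height at most 3 in absolute value, which contradicts the bound
      \<open>c + 6\<close>.\<close>
    then have "eventually (\<lambda>n. norm (vector [x n, (drift ^^ n) u - 3] :: plane) \<ge> c + 6) sequentially"
      unfolding orb by (simp add: filterlim_at_infinity[of 0] c_def)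
    then obtain N where N: "\<And>n. n \<ge> N \<Longrightarrow> norm (vector [x n, (drift ^^ n) u - 3] :: plane) \<ge> c + 6"
      by (auto simp: eventually_sequentially)
    \<comment> \<open>\<open>s\<close> bounds \<open>\<bar>ln\<bar>\<close> of the first
      \<open>N\<close> heights, so a visit near a level well beyond \<open>s\<close> happens at time
      \<open>N\<close> or later.\<close>
    define s where "s = (\<Sum>i<N. \<bar>ln ((drift ^^ i) u)\<bar>)"
    obtain m :: nat where m: "s + \<bar>ln u\<bar> + 2 < real m"
      using reals_Archimedean2 by blast
    define P where "P = exp (2 * pi * real m)"
    have P: "P \<ge> real m"
      using exp_level_ge[of 0 m] by (simp add: P_def)
    have "s \<ge> 0"
      by (auto simp: s_def intro: sum_nonneg)
    then obtain n where n: "\<bar>wave (- ln ((drift ^^ n) u)) - wave (P - 1)\<bar> \<le> 2"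
        "- ln ((drift ^^ n) u) \<ge> P - 1 - 1"
      using wave_drift_near[OF u, of "P - 1"] m P by (smt (verit))
    have "n \<ge> N"
    proof (rule ccontr)
      assume "\<not> n \<ge> N"
      then have "\<bar>ln ((drift ^^ n) u)\<bar> \<le> s"
        unfolding s_def by (intro member_le_sum) auto
      then show False
        using n(2) P m by linarith
    qed
    have "wave (P - 1) = 0"
      unfolding P_def by (rule wave_zeros)
    then have "\<bar>x n\<bar> \<le> c + 2"
      using n(1) unfolding x_def c_def by linarith
    moreover have "\<bar>(drift ^^ n) u - 3\<bar> \<le> 3"
      using drift_funpow_bounds[OF u, of n] by (simp add: abs_le_iff)
    moreover have "norm (vector [x n, (drift ^^ n) u - 3] :: plane) \<le> \<bar>x n\<bar> + \<bar>(drift ^^ n) u - 3\<bar>"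
      using norm_le_l1_cart[of "vector [x n, (drift ^^ n) u - 3] :: plane"] by (simp add: sum_2)
    ultimately show False
      using N[OF \<open>n \<ge> N\<close>] by linarith
  qed
  ultimately show ?thesis
    by (simp add: bungee_set_def)
qed

lemma frontier_bungee_set_mem: "vector [0, -3] \<in> frontier (bungee_set qrmap)"
proof -
  let ?v = "vector [0, -3] :: plane"
  have "qrmap ?v = ?v"
    by (simp add: qrmap_def eta_def shift_def height_def vector_2)
  then have "(qrmap ^^ n) ?v = ?v" for n
    by (induction n) auto
  then have "?v \<notin> bungee_set qrmap"
    by (simp add: bungee_set_def)
  moreover have "?v \<in> closure (bungee_set qrmap)"
    unfolding closure_approachable
  proof (intro allI impI)
    fix e :: real assume e: "e > 0"
    define u where "u = min (e / 2) (1 / 2)"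
    have u: "0 < u" "u < 1" "u < e"
      using e by (auto simp: u_def)
    have "dist (vector [0, u - 3]) ?v = u"
      using u by (simp add: dist_norm norm_vec_def L2_set_def sum_2)
    then show "\<exists>y\<in>bungee_set qrmap. dist y ?v < e"
      using strip_subset_bungee_set[OF u(1,2)] u(3) by metis
  qed
  ultimately show ?thesis
    using interior_subset by (auto simp: frontier_def)
qed

lemma not_julia_set_lower: "vector [0, -3] \<notin> julia_set qrmap"
proof
  define U :: "plane set" where "U = {v. v $ 2 < -2}"
  assume "vector [0, -3] \<in> julia_set qrmap"
  moreover have "open U"
    unfolding U_def by (intro open_Collect_less continuous_intros)
  ultimately have zero: "zero_capacity (UNIV - (\<Union>k\<in>{1..}. (qrmap ^^ k) ` U))"
    by (auto simp: julia_set_def U_def)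
  have step: "qrmap v \<in> U" if "v \<in> U" for v
    using that drift_bounds[of "v $ 2 + 3"] by (auto simp: U_def qrmap_def eta_def height_def)
  have "(qrmap ^^ k) v \<in> U" if "v \<in> U" for k v
    by (induction k) (use that step in auto)
  then have "(\<Union>k\<in>{1..}. (qrmap ^^ k) ` U) \<subseteq> U"
    by auto
  moreover have "vertical_segment (- pi/2) 3 4 \<subseteq> UNIV - U"
    by (auto simp: vertical_segment_def U_def)
  ultimately have "vertical_segment (- pi/2) 3 4 \<subseteq> UNIV - (\<Union>k\<in>{1..}. (qrmap ^^ k) ` U)"
    by blast
  then show False
    using not_zero_capacity_vertical_segment zero by force
qed

theorem theorem3:
  "\<exists>f. quasiregular f \<and> transcendental_type f \<and>
       \<not> zero_capacity (julia_set f) \<and> julia_set f \<noteq> frontier (bungee_set f)"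
proof (intro exI[of _ qrmap] conjI)
  show "\<not> zero_capacity (julia_set qrmap)"
    by (rule not_zero_capacity_vertical_segment[OF segment_subset_julia_set]) simp
  show "julia_set qrmap \<noteq> frontier (bungee_set qrmap)"
    using frontier_bungee_set_mem not_julia_set_lower by metis
qed (rule quasiregular_qrmap transcendental_type_qrmap)+

end
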